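(* Let $X(t)$, $a\le t\le b$, be a Yeh process associated with functions $\lambda$ (mean function) and $\rho$ (variance function) on $[a,b]$, and let $\widetilde X(t)=X(t)-\lambda(t)$ be the centered Yeh process. Let $\{\phi_n\}_{n=1}^\infty$ be an orthonormal basis for $L^2_\rho[a,b]$. Then for each $t\in[a,b]$, $$\widetilde X(t)=\sum_{n=1}^\infty\bigg(\int_a^t\phi_n(s)\,d\rho(s)\bigg)\bigg(\int_a^b\phi_n(s)\,d\widetilde X(s)\bigg),$$ $$X(t)=\lambda(t)+\sum_{n=1}^\infty\bigg(\int_a^t\phi_n(s)\,d\rho(s)\bigg)\bigg(\int_a^b\phi_n(s)\,d\widetilde X(s)\bigg),$$ where the series converge in $L^2(\Omega)$ and almost surely.
   Context: Fix a finite interval $[a,b]\subset[0,\infty)$. Standing assumptions: $\lambda$ is a continuous real-valued function of bounded variation on $[a,b]$; $\rho$ is a continuous monotonically increasing real-valued function on $[a,b]$ whose Lebesgue-Stieltjes measure is equivalent (mutually absolutely continuous) to Lebesgue measure on $[a,b]$. A Yeh process associated with $\lambda,\rho$ is a continuous real-valued stochastic process $X(t)$, $t\in[a,b]$, on a probability space $\Omega$, that is additive (has independent increments) and satisfies, for all $a\le s<t\le b$, $X(t)-X(s)\sim N(\lambda(t)-\lambda(s),\rho(t)-\rho(s))$, where $N(\mu,\sigma^2)$ is the normal distribution with mean $\mu$ and variance $\sigma^2$. It is also taken to satisfy $E[X(t)]=\lambda(t)$ for $a\le t\le b$ and $E[X(s)X(t)]=\rho(s)+\lambda(s)\lambda(t)$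 for $a\le s\le t\le b$. Thus $\widetilde X$ is a Yeh process associated with the functions $0$ and $\rho$. $L^2_\rho[a,b]$ is the Hilbert space of real functions $f$ on $[a,b]$ with $\int_a^b|f|^2\,d\rho<\infty$, with inner product $\langle f,g\rangle_\rho=\int_a^b fg\,d\rho$. Wiener integral with respect to $\widetilde X$: for a step function $f=\sum_{i=1}^n c_i1_{[t_{i-1},t_i)}$ with $a=t_0<\dots<t_n=b$ and $c_i\in\mathbb R$, set $\widetilde I(f)=\sum_{i=1}^n c_i(\widetilde X(t_i)-\widetilde X(t_{i-1}))$. Step functions are dense in $L^2_\rho[a,b]$; for $f\in L^2_\rho[a,b]$, $\widetilde I(f)=\int_a^b f(t)\,d\widetilde X(t)$ is defined as the $L^2(\Omega)$-limit of $\widetilde I(f_n)$ for any sequence of step functions $f_n$ converging to $f$ in $L^2_\rho[a,b]$ (the limit exists and does not depend on the sequence).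
   Formalization: The two expansions are proved as stated when ρ(a)=0; for general ρ the term X̃(a) is added to the right-hand sides, since X̃(a) has variance ρ(a) while the series vanishes at t=a (e.g. Brownian motion on [1,2]), so the claim fails if ρ(a)≠0. *)

theory Defs
  imports "HOL-Probability.Probability"
begin

definition is_partition :: "real \<Rightarrow> real \<Rightarrow> nat \<Rightarrow> (nat \<Rightarrow> real) \<Rightarrow> bool" where
  "is_partition a b n \<tau> \<longleftrightarrow> \<tau> 0 = a \<and> \<tau> n = b \<and> (\<forall>i<n. \<tau> i < \<tau> (Suc i))"

definition bounded_variation_on :: "real \<Rightarrow> real \<Rightarrow> (real \<Rightarrow> real) \<Rightarrow> bool" where
  "bounded_variation_on a b f \<longleftrightarrow>
     (\<exists>B. \<forall>n \<tau>. is_partition a b n \<tau> \<longrightarrow> (\<Sum>i<n. \<bar>f (\<tau> (Suc i)) - f (\<tau> i)\<bar>) \<le> B)"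

text \<open>The complete Lebesgue-Stieltjes measure of a continuous monotone \<open>\<rho>\<close> on \<open>[a,b]\<close>.
  Only the values of \<open>\<rho>\<close> on \<open>[a,b]\<close> are used: it is extended by constants, because
  \<^const>\<open>interval_measure\<close> expects a function that is monotone on all of the real line.\<close>

definition stieltjes_on :: "real \<Rightarrow> real \<Rightarrow> (real \<Rightarrow> real) \<Rightarrow> real measure" where
  "stieltjes_on a b \<rho> =
     completion (restrict_space (interval_measure (\<lambda>x. \<rho> (max a (min x b)))) {a..b})"

definition equivalent_measures :: "'a measure \<Rightarrow> 'a measure \<Rightarrow> bool" where
  "equivalent_measures M N \<longleftrightarrow> absolutely_continuous M N \<and> absolutely_continuous N M"

definition sq_integrable :: "'a measure \<Rightarrow> ('a \<Rightarrow> real) \<Rightarrow> bool" where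
  "sq_integrable M f \<longleftrightarrow> f \<in> borel_measurable M \<and> integrable M (\<lambda>x. (f x)\<^sup>2)"

definition L2_tendsto :: "'a measure \<Rightarrow> (nat \<Rightarrow> 'a \<Rightarrow> real) \<Rightarrow> ('a \<Rightarrow> real) \<Rightarrow> bool" where
  "L2_tendsto M F f \<longleftrightarrow>
     (\<forall>n. sq_integrable M (F n)) \<and> sq_integrable M f \<and>
     (\<lambda>n. LINT x|M. (F n x - f x)\<^sup>2) \<longlonglongrightarrow> 0"

definition orthonormal_basis :: "'a measure \<Rightarrow> (nat \<Rightarrow> 'a \<Rightarrow> real) \<Rightarrow> bool" where
  "orthonormal_basis M \<phi> \<longleftrightarrow>
     (\<forall>n. sq_integrable M (\<phi> n)) \<and>
     (\<forall>m n. (LINT x|M. \<phi> m x * \<phi> n x) = (if m = n then 1 else 0)) \<and>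
     (\<forall>f. sq_integrable M f \<longrightarrow>
        (\<forall>\<epsilon>>0. \<exists>N c. (LINT x|M. (f x - (\<Sum>n<N. c n * \<phi> n x))\<^sup>2) < \<epsilon>))"

definition independent_increments ::
    "'w measure \<Rightarrow> real \<Rightarrow> real \<Rightarrow> (real \<Rightarrow> 'w \<Rightarrow> real) \<Rightarrow> bool" where
  "independent_increments M a b X \<longleftrightarrow>
     (\<forall>n \<tau>. a \<le> \<tau> 0 \<and> (\<forall>i<n. \<tau> i < \<tau> (Suc i)) \<and> \<tau> n \<le> b \<longrightarrow>
        prob_space.indep_vars M (\<lambda>_. borel) (\<lambda>i \<omega>. X (\<tau> (Suc i)) \<omega> - X (\<tau> i) \<omega>) {..<n})"

text \<open>The normal law is given by its density, which is adequate only for nonzero variance; this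
  is the case here, since a \<open>\<rho>\<close> whose Stieltjes measure is equivalent to Lebesgue measure is
  strictly increasing. Square integrability is listed separately because the Bochner integral
  of a non-integrable function is \<open>0\<close>.\<close>

definition yeh_process ::
    "'w measure \<Rightarrow> real \<Rightarrow> real \<Rightarrow> (real \<Rightarrow> real) \<Rightarrow> (real \<Rightarrow> real) \<Rightarrow> (real \<Rightarrow> 'w \<Rightarrow> real) \<Rightarrow> bool" where
  "yeh_process M a b lam \<rho> X \<longleftrightarrow>
     prob_space M \<and>
     (\<forall>t\<in>{a..b}. X t \<in> borel_measurable M) \<and>
     (AE \<omega> in M. continuous_on {a..b} (\<lambda>t. X t \<omega>)) \<and>
     independent_increments M a b X \<and>
     (\<forall>s t. a \<le> s \<and> s < t \<and> t \<le> b \<longrightarrow>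
        distributed M lborel (\<lambda>\<omega>. X t \<omega> - X s \<omega>)
          (\<lambda>x. ennreal (normal_density (lam t - lam s) (sqrt (\<rho> t - \<rho> s)) x))) \<and>
     (\<forall>t\<in>{a..b}. sq_integrable M (X t)) \<and>
     (\<forall>t\<in>{a..b}. (LINT \<omega>|M. X t \<omega>) = lam t) \<and>
     (\<forall>s t. a \<le> s \<and> s \<le> t \<and> t \<le> b \<longrightarrow>
        (LINT \<omega>|M. X s \<omega> * X t \<omega>) = \<rho> s + lam s * lam t)"

definition step_fun :: "nat \<Rightarrow> (nat \<Rightarrow> real) \<Rightarrow> (nat \<Rightarrow> real) \<Rightarrow> real \<Rightarrow> real" where
  "step_fun n \<tau> c x = (\<Sum>i<n. c i * indicator {\<tau> i..<\<tau> (Suc i)} x)"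

definition step_integral ::
    "(real \<Rightarrow> 'w \<Rightarrow> real) \<Rightarrow> nat \<Rightarrow> (nat \<Rightarrow> real) \<Rightarrow> (nat \<Rightarrow> real) \<Rightarrow> 'w \<Rightarrow> real" where
  "step_integral Y n \<tau> c \<omega> = (\<Sum>i<n. c i * (Y (\<tau> (Suc i)) \<omega> - Y (\<tau> i) \<omega>))"

definition is_wiener_integral ::
    "'w measure \<Rightarrow> real \<Rightarrow> real \<Rightarrow> (real \<Rightarrow> real) \<Rightarrow> (real \<Rightarrow> 'w \<Rightarrow> real) \<Rightarrow>
     (real \<Rightarrow> real) \<Rightarrow> ('w \<Rightarrow> real) \<Rightarrow> bool" where
  "is_wiener_integral M a b \<rho> Y f Z \<longleftrightarrow>
     sq_integrable M Z \<and>
     (\<forall>n \<tau> c. (\<forall>k. is_partition a b (n k) (\<tau> k)) \<and>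
        L2_tendsto (stieltjes_on a b \<rho>) (\<lambda>k. step_fun (n k) (\<tau> k) (c k)) f \<longrightarrow>
        L2_tendsto M (\<lambda>k. step_integral Y (n k) (\<tau> k) (c k)) Z)"

text \<open>An arbitrary representative of the \<open>L\<^sup>2\<close>-class; two representatives agree almost surely.\<close>

definition wiener_integral ::
    "'w measure \<Rightarrow> real \<Rightarrow> real \<Rightarrow> (real \<Rightarrow> real) \<Rightarrow> (real \<Rightarrow> 'w \<Rightarrow> real) \<Rightarrow>
     (real \<Rightarrow> real) \<Rightarrow> 'w \<Rightarrow> real" where
  "wiener_integral M a b \<rho> Y f = (SOME Z. is_wiener_integral M a b \<rho> Y f Z)"

definition centered :: "(real \<Rightarrow> real) \<Rightarrow> (real \<Rightarrow> 'w \<Rightarrow> real) \<Rightarrow> real \<Rightarrow> 'w \<Rightarrow> real" where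
  "centered lam X t \<omega> = X t \<omega> - lam t"

definition series_partial ::
    "'w measure \<Rightarrow> real \<Rightarrow> real \<Rightarrow> (real \<Rightarrow> real) \<Rightarrow> (real \<Rightarrow> 'w \<Rightarrow> real) \<Rightarrow>
     (nat \<Rightarrow> real \<Rightarrow> real) \<Rightarrow> real \<Rightarrow> nat \<Rightarrow> 'w \<Rightarrow> real" where
  "series_partial M a b \<rho> Y \<phi> t N \<omega> =
     (\<Sum>n<N. (LINT s:{a..t}|stieltjes_on a b \<rho>. \<phi> n s) * wiener_integral M a b \<rho> Y (\<phi> n) \<omega>)"

definition tendsto_L2_and_AE ::
    "'w measure \<Rightarrow> (nat \<Rightarrow> 'w \<Rightarrow> real) \<Rightarrow> ('w \<Rightarrow> real) \<Rightarrow> bool" where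
  "tendsto_L2_and_AE M S Z \<longleftrightarrow>
     L2_tendsto M S Z \<and> (AE \<omega> in M. (\<lambda>N. S N \<omega>) \<longlonglongrightarrow> Z \<omega>)"

end

theory Submission
  imports Defs
begin

text \<open>Let \<open>Y = X - \<lambda>\<close>. The covariance of \<open>Y\<close> says that the indicators of \<open>[a, s)\<close> in \<open>L\<^sup>2\<^sub>\<rho>\<close>
  and the increments \<open>Y s - Y a\<close> in \<open>L\<^sup>2(\<Omega>)\<close> have the same inner products, namely
  \<open>\<rho> (min s t) - \<rho> a\<close>. Hence the correspondence between them extends to an isometry of all of
  \<open>L\<^sup>2\<^sub>\<rho>\<close> into \<open>L\<^sup>2(\<Omega>)\<close>, the Wiener integral
  (\<open>corresponds_exists\<close>, \<open>corresponds_wiener_integral\<close>). Expanding the indicator of \<open>[a, t)\<close> in the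
  basis \<open>\<phi>\<close> gives the Fourier coefficients \<open>\<integral>\<^sub>a\<^sup>t \<phi>\<^sub>n d\<rho>\<close>, and the isometry carries the
  expansion to the stated series for \<open>Y t - Y a\<close>, convergent in mean square. The initial value
  \<open>Y a\<close> has variance \<open>\<rho> a\<close>, so it vanishes almost surely when \<open>\<rho> a = 0\<close>.

  Almost sure convergence is usually deduced from the independence of the Wiener integrals of
  orthogonal functions. The proof below uses moments of single integrals instead. A Wiener integral
  \<open>Z\<close> is a limit of Gaussian step integrals, so \<open>E Z\<^sup>4 \<le> 3 (E Z\<^sup>2)\<^sup>2\<close>
  (\<open>corresponds_fourth_moment\<close>). Therefore the partial sums \<open>S\<close> of the series satisfy
  \<open>E (S j - S i)\<^sup>4 \<le> 3 (V j - V i)\<^sup>2\<close>, where \<open>V\<close> are the partial sums of the squared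
  coefficients, a bounded increasing sequence. Since the exponent of \<open>V j - V i\<close> exceeds \<open>1\<close>, a
  chaining argument bounds the fourth moment of the maximal oscillation by a constant times
  \<open>(V j - V i)\<^sup>2\<close> (\<open>maximal_fourth_moment\<close>), and almost sure convergence follows
  (\<open>AE_convergent_of_fourth_moments\<close>).\<close>

section \<open>Square-integrable functions\<close>

lemma sq_integrable_measurable [measurable_dest]:
  "sq_integrable M f \<Longrightarrow> f \<in> borel_measurable M"
  by (simp add: sq_integrable_def)

lemma sq_integrable_product:
  assumes "sq_integrable M f" "sq_integrable M g"
  shows "integrable M (\<lambda>x. f x * g x)"
proof (rule Bochner_Integration.integrable_bound)
  show "integrable M (\<lambda>x. (f x)\<^sup>2 + (g x)\<^sup>2)"
    using assms by (simp add: sq_integrable_def)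
  show "(\<lambda>x. f x * g x) \<in> borel_measurable M"
    using assms by measurable
  have "\<bar>u * v\<bar> \<le> u\<^sup>2 + v\<^sup>2" for u v :: real
  proof -
    have "2 * (\<bar>u\<bar> * \<bar>v\<bar>) \<le> u\<^sup>2 + v\<^sup>2"
      using sum_squares_bound[of "\<bar>u\<bar>" "\<bar>v\<bar>"] by simp
    moreover have "0 \<le> \<bar>u\<bar> * \<bar>v\<bar>" by simp
    ultimately show ?thesis by (simp only: abs_mult)
  qed
  then show "AE x in M. norm (f x * g x) \<le> norm ((f x)\<^sup>2 + (g x)\<^sup>2)"
    by simp
qed

lemma sq_integrable_add:
  assumes "sq_integrable M f" "sq_integrable M g"
  shows "sq_integrable M (\<lambda>x. f x + g x)"
proof -
  have "integrable M (\<lambda>x. (f x + g x)\<^sup>2)"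
    using assms sq_integrable_product[OF assms]
    by (simp add: sq_integrable_def power2_sum mult.assoc)
  moreover have "(\<lambda>x. f x + g x) \<in> borel_measurable M"
    using assms by measurable
  ultimately show ?thesis by (simp add: sq_integrable_def)
qed

lemma sq_integrable_cmult:
  "sq_integrable M f \<Longrightarrow> sq_integrable M (\<lambda>x. c * f x)"
  by (auto simp: sq_integrable_def power_mult_distrib)

lemma sq_integrable_diff:
  assumes "sq_integrable M f" "sq_integrable M g"
  shows "sq_integrable M (\<lambda>x. f x - g x)"
  using sq_integrable_add[OF assms(1) sq_integrable_cmult[OF assms(2), of "-1"]] by simp

lemma sq_integrable_zero: "sq_integrable M (\<lambda>x. 0)"
  by (simp add: sq_integrable_def)

lemma sq_integrable_sum:
  assumes "\<And>i. i \<in> I \<Longrightarrow> sq_integrable M (f i)"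
  shows "sq_integrable M (\<lambda>x. \<Sum>i\<in>I. f i x)"
  using assms
  by (induction I rule: infinite_finite_induct) (auto simp: sq_integrable_zero intro: sq_integrable_add)

lemma sq_integrable_bounded:
  assumes "finite_measure M" "f \<in> borel_measurable M" "\<And>x. \<bar>f x\<bar> \<le> B"
  shows "sq_integrable M f"
proof -
  interpret finite_measure M by fact
  have "(f x)\<^sup>2 \<le> B\<^sup>2" for x
    using assms(3)[of x] by (simp add: abs_le_square_iff[symmetric])
  then have "integrable M (\<lambda>x. (f x)\<^sup>2)"
    using assms(2) by (intro integrable_const_bound[where B="B\<^sup>2"]) auto
  with assms(2) show ?thesis by (simp add: sq_integrable_def)
qed

abbreviation sqnorm :: "'a measure \<Rightarrow> ('a \<Rightarrow> real) \<Rightarrow> real" where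
  "sqnorm M f \<equiv> (LINT x|M. (f x)\<^sup>2)"

lemma sqnorm_nonneg: "0 \<le> sqnorm M f"
  by simp

lemma sqnorm_cong_AE:
  assumes "sq_integrable M f" "sq_integrable M g" "AE x in M. f x = g x"
  shows "sqnorm M f = sqnorm M g"
  using assms by (intro integral_cong_AE) (auto simp: sq_integrable_def)

lemma sqnorm_add_le:
  assumes "sq_integrable M f" "sq_integrable M g"
  shows "sqnorm M (\<lambda>x. f x + g x) \<le> 2 * sqnorm M f + 2 * sqnorm M g"
proof -
  have ints: "integrable M (\<lambda>x. (f x)\<^sup>2)" "integrable M (\<lambda>x. (g x)\<^sup>2)"
    using assms by (auto simp: sq_integrable_def)
  have "sqnorm M (\<lambda>x. f x + g x) \<le> (LINT x|M. 2 * (f x)\<^sup>2 + 2 * (g x)\<^sup>2)"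
  proof (rule integral_mono)
    show "integrable M (\<lambda>x. (f x + g x)\<^sup>2)"
      using sq_integrable_add[OF assms] by (simp add: sq_integrable_def)
    fix x
    show "(f x + g x)\<^sup>2 \<le> 2 * (f x)\<^sup>2 + 2 * (g x)\<^sup>2"
      using sum_squares_bound[of "f x" "g x"] by (simp add: power2_sum)
  qed (use ints in auto)
  also have "\<dots> = 2 * sqnorm M f + 2 * sqnorm M g"
    using ints by simp
  finally show ?thesis .
qed

lemma sqnorm_diff_triangle:
  assumes "sq_integrable M f" "sq_integrable M g" "sq_integrable M h"
  shows "sqnorm M (\<lambda>x. f x - h x) \<le> 2 * sqnorm M (\<lambda>x. f x - g x) + 2 * sqnorm M (\<lambda>x. g x - h x)"
  using sqnorm_add_le[OF sq_integrable_diff[OF assms(1,2)] sq_integrable_diff[OF assms(2,3)]]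
  by simp

lemma sqnorm_cmult: "sqnorm M (\<lambda>x. c * f x) = c\<^sup>2 * sqnorm M f"
  by (simp add: power_mult_distrib)

lemma sqnorm_commute: "sqnorm M (\<lambda>x. f x - g x) = sqnorm M (\<lambda>x. g x - f x)"
  by (simp add: power2_commute)

lemma sqnorm_zero_imp_AE:
  assumes "sq_integrable M f" "sqnorm M f = 0"
  shows "AE x in M. f x = 0"
  using assms integral_nonneg_eq_0_iff_AE[of M "\<lambda>x. (f x)\<^sup>2"] by (simp add: sq_integrable_def)

lemma sqnorm_eq_nn_integral:
  assumes "sq_integrable M f"
  shows "(\<integral>\<^sup>+x. ennreal ((f x)\<^sup>2) \<partial>M) = ennreal (sqnorm M f)"
  using assms by (intro nn_integral_eq_integral) (auto simp: sq_integrable_def)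

text \<open>Instead of the Cauchy--Schwarz inequality, the weighted estimate
  \<open>\<bar>u\<^sup>2 - v\<^sup>2\<bar> \<le> \<epsilon> v\<^sup>2 + (1 + 1/\<epsilon>) (u - v)\<^sup>2\<close> is integrated, and \<open>\<epsilon>\<close> is
  chosen after the distance is known to be small.\<close>

lemma sqnorm_tendsto:
  assumes "L2_tendsto M F f"
  shows "(\<lambda>n. sqnorm M (F n)) \<longlonglongrightarrow> sqnorm M f"
proof (rule LIMSEQ_I)
  fix r :: real assume r: "0 < r"
  have Fi: "\<And>n. sq_integrable M (F n)" and fi: "sq_integrable M f"
    and lim: "(\<lambda>n. sqnorm M (\<lambda>x. F n x - f x)) \<longlonglongrightarrow> 0"
    using assms by (auto simp: L2_tendsto_def)
  define e where "e = r / (2 * (sqnorm M f + 1))"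
  have "0 < sqnorm M f + 1" using sqnorm_nonneg[of M f] by linarith
  then have e: "0 < e" using r by (simp add: e_def)
  have e1: "e * sqnorm M f \<le> r / 2"
    using \<open>0 < sqnorm M f + 1\<close> r by (simp add: e_def divide_simps)
  define d where "d = r / (2 * (1 + 1 / e))"
  have d: "0 < d" using r e by (simp add: d_def add_pos_pos)
  have pt: "\<bar>u\<^sup>2 - v\<^sup>2\<bar> \<le> e * v\<^sup>2 + (1 + 1 / e) * (u - v)\<^sup>2" for u v :: real
  proof -
    have 1: "2 * (\<bar>v\<bar> * \<bar>u - v\<bar>) \<le> e * v\<^sup>2 + (1 / e) * (u - v)\<^sup>2"
      using sum_squares_bound[of "sqrt e * \<bar>v\<bar>" "\<bar>u - v\<bar> / sqrt e"] e
      by (simp add: power_mult_distrib power_divide)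
    have "\<bar>u\<^sup>2 - v\<^sup>2\<bar> = \<bar>2 * (v * (u - v)) + (u - v)\<^sup>2\<bar>"
      by (simp add: power2_eq_square algebra_simps)
    also have "\<dots> \<le> \<bar>2 * (v * (u - v))\<bar> + \<bar>(u - v)\<^sup>2\<bar>" by (rule abs_triangle_ineq)
    also have "\<dots> = 2 * (\<bar>v\<bar> * \<bar>u - v\<bar>) + (u - v)\<^sup>2" by (simp add: abs_mult)
    finally show ?thesis using 1 by (simp add: algebra_simps)
  qed
  have "eventually (\<lambda>n. sqnorm M (\<lambda>x. F n x - f x) < d) sequentially"
    using order_tendstoD(2)[OF lim d] .
  then obtain n0 where n0: "\<And>n. n \<ge> n0 \<Longrightarrow> sqnorm M (\<lambda>x. F n x - f x) < d"
    by (auto simp: eventually_sequentially)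
  show "\<exists>no. \<forall>n\<ge>no. norm (sqnorm M (F n) - sqnorm M f) < r"
  proof (intro exI[of _ n0] allI impI)
    fix n assume n: "n0 \<le> n"
    have i1: "integrable M (\<lambda>x. (F n x)\<^sup>2)" "integrable M (\<lambda>x. (f x)\<^sup>2)"
      "integrable M (\<lambda>x. (F n x - f x)\<^sup>2)"
      using Fi fi sq_integrable_diff[OF Fi fi] by (auto simp: sq_integrable_def)
    have "\<bar>sqnorm M (F n) - sqnorm M f\<bar> = \<bar>LINT x|M. (F n x)\<^sup>2 - (f x)\<^sup>2\<bar>"
      using i1 by simp
    also have "\<dots> \<le> (LINT x|M. \<bar>(F n x)\<^sup>2 - (f x)\<^sup>2\<bar>)" by (rule integral_abs_bound)
    also have "\<dots> \<le> (LINT x|M. e * (f x)\<^sup>2 + (1 + 1 / e) * (F n x - f x)\<^sup>2)"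
      using i1 pt by (intro integral_mono) auto
    also have "\<dots> = e * sqnorm M f + (1 + 1 / e) * sqnorm M (\<lambda>x. F n x - f x)"
      using i1 by simp
    also have "\<dots> < r / 2 + (1 + 1 / e) * d"
      using n0[OF n] e e1 by (intro add_le_less_mono mult_strict_left_mono) (auto intro: add_pos_pos)
    also have "\<dots> = r"
    proof -
      have "1 + 1 / e > 0" using e by (simp add: add_pos_pos)
      then show ?thesis by (simp add: d_def divide_simps)
    qed
    finally show "norm (sqnorm M (F n) - sqnorm M f) < r" by simp
  qed
qed

lemma L2_tendstoI:
  assumes "\<And>n. sq_integrable M (F n)" "sq_integrable M f"
    "\<And>n. sqnorm M (\<lambda>x. F n x - f x) \<le> u n" "u \<longlonglongrightarrow> 0"
  shows "L2_tendsto M F f"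
  unfolding L2_tendsto_def
proof (intro conjI allI)
  show "(\<lambda>n. sqnorm M (\<lambda>x. F n x - f x)) \<longlonglongrightarrow> 0"
    by (rule tendsto_sandwich[OF _ _ tendsto_const assms(4)]) (use assms(3) in auto)
qed (use assms in auto)

lemma L2_tendsto_AE_subseq:
  assumes "L2_tendsto M F f"
  obtains r :: "nat \<Rightarrow> nat" where "strict_mono r" "AE x in M. (\<lambda>n. F (r n) x) \<longlonglongrightarrow> f x"
proof -
  have d: "sq_integrable M (\<lambda>x. F n x - f x)" for n
    using assms by (auto simp: L2_tendsto_def intro: sq_integrable_diff)
  have "\<exists>r. strict_mono r \<and> (AE x in M. (\<lambda>n. (F (r n) x - f x)\<^sup>2) \<longlonglongrightarrow> 0)"
    using d assms by (intro tendsto_L1_AE_subseq) (auto simp: sq_integrable_def L2_tendsto_def)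
  then obtain r where r: "strict_mono r" "AE x in M. (\<lambda>n. (F (r n) x - f x)\<^sup>2) \<longlonglongrightarrow> 0"
    by blast
  have "(\<lambda>n. F (r n) x) \<longlonglongrightarrow> f x" if "(\<lambda>n. (F (r n) x - f x)\<^sup>2) \<longlonglongrightarrow> 0" for x
  proof -
    have "(\<lambda>n. sqrt ((F (r n) x - f x)\<^sup>2)) \<longlonglongrightarrow> 0" using tendsto_real_sqrt[OF that] by simp
    then show ?thesis by (simp add: tendsto_rabs_zero_iff LIM_zero_iff)
  qed
  with r show ?thesis by (intro that[OF r(1)]) auto
qed

lemma nn_integral_Fatou_real:
  fixes F :: "nat \<Rightarrow> 'a \<Rightarrow> real"
  assumes "\<And>n. F n \<in> borel_measurable M" "AE x in M. (\<lambda>n. F n x) \<longlonglongrightarrow> f x"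
    and "\<And>n. (\<integral>\<^sup>+x. ennreal (F n x) \<partial>M) \<le> ennreal (u n)" "u \<longlonglongrightarrow> c"
  shows "(\<integral>\<^sup>+x. ennreal (f x) \<partial>M) \<le> ennreal c"
proof -
  have "(\<integral>\<^sup>+x. ennreal (f x) \<partial>M) = (\<integral>\<^sup>+x. liminf (\<lambda>n. ennreal (F n x)) \<partial>M)"
  proof (rule nn_integral_cong_AE)
    show "AE x in M. ennreal (f x) = liminf (\<lambda>n. ennreal (F n x))"
      using assms(2)
    proof eventually_elim
      case (elim x)
      then have "(\<lambda>n. ennreal (F n x)) \<longlonglongrightarrow> ennreal (f x)" by (rule tendsto_ennrealI)
      then show ?case by (intro lim_imp_Liminf[symmetric]) auto
    qed
  qed
  also have "\<dots> \<le> liminf (\<lambda>n. \<integral>\<^sup>+x. ennreal (F n x) \<partial>M)"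
    using assms(1) by (intro nn_integral_liminf) auto
  also have "\<dots> \<le> liminf (\<lambda>n. ennreal (u n))"
    using assms(3) by (intro Liminf_mono) auto
  also have "\<dots> = ennreal c"
    using tendsto_ennrealI[OF assms(4)] by (intro lim_imp_Liminf) auto
  finally show ?thesis .
qed

text \<open>The usual proof that \<open>L\<^sup>2\<close> is complete: along a subsequence \<open>G\<close> with
  \<open>\<parallel>G k - G (k + 1)\<parallel>\<^sup>2 \<le> 4\<^sup>-\<^sup>k\<close>, the sum of \<open>2\<^sup>k (G k - G (k + 1))\<^sup>2\<close> has finite
  integral, so almost everywhere the increments are eventually dominated by a geometric sequence.
  Fatou's lemma turns the pointwise limit into the limit in mean square.\<close>

lemma L2_complete:
  assumes F: "\<And>n. sq_integrable M (F n)"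
    and u: "u \<longlonglongrightarrow> 0"
    and cau: "\<And>m n. m \<le> n \<Longrightarrow> sqnorm M (\<lambda>x. F m x - F n x) \<le> u m"
  obtains f where "L2_tendsto M F f"
proof -
  have "\<exists>r::nat\<Rightarrow>nat. strict_mono r \<and> (\<forall>k. u (r k) < (1/4)^k)"
  proof -
    have ev: "\<exists>N. \<forall>n\<ge>N. u n < (1/4)^k" for k :: nat
      using order_tendstoD(2)[OF u, of "(1/4)^k"] by (auto simp: eventually_sequentially)
    then obtain N where N: "\<And>k n. N k \<le> n \<Longrightarrow> u n < (1/4)^k" by metis
    define r where "r = rec_nat (N 0) (\<lambda>k p. Suc (max p (N (Suc k))))"
    have "strict_mono r" by (rule strict_monoI_Suc) (simp add: r_def less_Suc_eq_le)
    moreover have "N k \<le> r k" for k by (cases k) (auto simp: r_def)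
    ultimately show ?thesis using N by blast
  qed
  then obtain r where r: "strict_mono r" "\<And>k. u (r k) < (1/4)^k" by blast
  define G where "G k = F (r k)" for k
  have G: "\<And>k. sq_integrable M (G k)" using F by (simp add: G_def)
  have Gm[measurable]: "\<And>k. G k \<in> borel_measurable M" using G by (simp add: sq_integrable_def)
  have inc: "(\<integral>\<^sup>+x. ennreal ((G k x - G (Suc k) x)\<^sup>2) \<partial>M) \<le> ennreal ((1/4)^k)" for k
  proof -
    have "r k \<le> r (Suc k)" using r(1) by (simp add: strict_mono_def less_imp_le)
    then have "sqnorm M (\<lambda>x. G k x - G (Suc k) x) \<le> u (r k)" unfolding G_def by (rule cau)
    then show ?thesis
      using r(2)[of k] by (subst sqnorm_eq_nn_integral) (auto intro!: sq_integrable_diff G ennreal_leI)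
  qed
  have "(\<integral>\<^sup>+x. (\<Sum>k. ennreal (2^k * (G k x - G (Suc k) x)\<^sup>2)) \<partial>M)
      = (\<Sum>k. \<integral>\<^sup>+x. ennreal (2^k * (G k x - G (Suc k) x)\<^sup>2) \<partial>M)"
    by (rule nn_integral_suminf) measurable
  also have "\<dots> \<le> (\<Sum>k. ennreal ((1/2)^k))"
  proof (rule suminf_le)
    fix k
    have "(\<integral>\<^sup>+x. ennreal (2^k * (G k x - G (Suc k) x)\<^sup>2) \<partial>M)
       = ennreal (2^k) * (\<integral>\<^sup>+x. ennreal ((G k x - G (Suc k) x)\<^sup>2) \<partial>M)"
      by (subst nn_integral_cmult[symmetric]) (auto simp: ennreal_mult)
    also have "\<dots> \<le> ennreal (2^k) * ennreal ((1/4)^k)" by (intro mult_left_mono inc) simp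
    also have "\<dots> = ennreal ((1/2)^k)"
      by (simp add: ennreal_mult[symmetric] power_mult_distrib[symmetric])
    finally show "(\<integral>\<^sup>+x. ennreal (2^k * (G k x - G (Suc k) x)\<^sup>2) \<partial>M) \<le> ennreal ((1/2)^k)" .
  qed auto
  also have "\<dots> < \<infinity>"
    by (subst suminf_ennreal2) (auto intro!: summable_geometric)
  finally have fin: "(\<integral>\<^sup>+x. (\<Sum>k. ennreal (2^k * (G k x - G (Suc k) x)\<^sup>2)) \<partial>M) \<noteq> \<infinity>" by simp
  have "AE x in M. (\<Sum>k. ennreal (2^k * (G k x - G (Suc k) x)\<^sup>2)) \<noteq> \<infinity>"
    by (rule nn_integral_PInf_AE[OF _ fin]) measurable
  then have AEc: "AE x in M. convergent (\<lambda>k. G k x)"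
  proof eventually_elim
    case (elim x)
    define D where "D k = G k x - G (Suc k) x" for k
    have "summable (\<lambda>k. 2^k * (D k)\<^sup>2)"
      using elim unfolding D_def by (intro summable_suminf_not_top) auto
    then have "(\<lambda>k. 2^k * (D k)\<^sup>2) \<longlonglongrightarrow> 0" by (rule summable_LIMSEQ_zero)
    then have "eventually (\<lambda>k. 2^k * (D k)\<^sup>2 < 1) sequentially" by (rule order_tendstoD) simp
    then have "eventually (\<lambda>k. norm (D k) \<le> (sqrt (1/2))^k) sequentially"
    proof eventually_elim
      case (elim k)
      have "(D k)\<^sup>2 \<le> (1/2)^k" using elim by (simp add: divide_simps mult.commute)
      then have "sqrt ((D k)\<^sup>2) \<le> sqrt ((1/2)^k)" by (rule real_sqrt_le_mono)
      then show ?case unfolding real_sqrt_abs by (simp add: real_sqrt_power)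
    qed
    then have "summable D"
      by (rule summable_comparison_test_ev) (auto intro!: summable_geometric)
    then have "summable (\<lambda>k. G (Suc k) x - G k x)"
      using summable_minus[of D] by (simp add: D_def)
    then have "convergent (\<lambda>n. \<Sum>k<n. G (Suc k) x - G k x)"
      by (simp add: summable_iff_convergent)
    then have "convergent (\<lambda>n. G n x - G 0 x)" by (simp only: sum_lessThan_telescope[of "\<lambda>k. G k x"])
    then obtain l where "(\<lambda>n. G n x - G 0 x) \<longlonglongrightarrow> l" by (auto simp: convergent_def)
    from tendsto_add[OF this tendsto_const[of "G 0 x"]]
    show ?case by (auto simp: convergent_def)
  qed
  define f where "f x = lim (\<lambda>k. G k x)" for x
  have fm[measurable]: "f \<in> borel_measurable M" unfolding f_def by measurable
  have AEf: "AE x in M. (\<lambda>k. G k x) \<longlonglongrightarrow> f x"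
    using AEc by eventually_elim (simp add: f_def convergent_LIMSEQ_iff)
  have bnd: "(\<integral>\<^sup>+x. ennreal ((F m x - f x)\<^sup>2) \<partial>M) \<le> ennreal (u m)" for m
  proof (rule nn_integral_Fatou_real[where F="\<lambda>k x. (F m x - G (k + m) x)\<^sup>2" and u="\<lambda>k. u m"])
    show "(\<lambda>x. (F m x - G (k + m) x)\<^sup>2) \<in> borel_measurable M" for k
      using F[of m] by measurable
    show "AE x in M. (\<lambda>k. (F m x - G (k + m) x)\<^sup>2) \<longlonglongrightarrow> (F m x - f x)\<^sup>2"
      using AEf by eventually_elim (intro tendsto_intros LIMSEQ_ignore_initial_segment)
    fix k
    have "m \<le> r (k + m)" using seq_suble[OF r(1), of "k + m"] by simp
    then show "(\<integral>\<^sup>+x. ennreal ((F m x - G (k + m) x)\<^sup>2) \<partial>M) \<le> ennreal (u m)"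
      using cau[of m "r (k + m)"]
      by (subst sqnorm_eq_nn_integral) (auto simp: G_def intro!: sq_integrable_diff F ennreal_leI)
  qed simp
  have dsq: "sq_integrable M (\<lambda>x. F m x - f x)" for m
  proof -
    have [measurable]: "F m \<in> borel_measurable M" using F[of m] by measurable
    have "integrable M (\<lambda>x. (F m x - f x)\<^sup>2)"
      using order.strict_trans1[OF bnd[of m] ennreal_less_top]
      by (intro integrableI_bounded) auto
    then show ?thesis by (simp add: sq_integrable_def)
  qed
  have fsq: "sq_integrable M f"
    using sq_integrable_diff[OF F[of 0] dsq[of 0]] by simp
  have "L2_tendsto M F f"
  proof (rule L2_tendstoI[OF F fsq _ u])
    fix m
    have "0 \<le> sqnorm M (\<lambda>x. F m x - F m x)" by simp
    also have "\<dots> \<le> u m" using cau[of m m] by simp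
    finally have "0 \<le> u m" .
    then show "sqnorm M (\<lambda>x. F m x - f x) \<le> u m"
      using bnd[of m] sqnorm_eq_nn_integral[OF dsq] by (simp add: ennreal_le_iff)
  qed
  then show thesis by (rule that)
qed

section \<open>Almost sure convergence from a fourth-moment bound\<close>

text \<open>Two applications of \<open>(p + q)\<^sup>2 \<le> 5 p\<^sup>2 + (5/4) q\<^sup>2\<close>. The weight \<open>125/64\<close> of \<open>y\<close> must stay below \<open>2\<close>
  in the bisection argument that follows, at the price of a large weight of \<open>x\<close>.\<close>

lemma fourth_power_add_le:
  fixes x y :: real
  shows "(x + y)^4 \<le> 125 * x^4 + (125/64) * y^4"
proof -
  have sq: "(p + q)\<^sup>2 \<le> 5 * p\<^sup>2 + (5/4) * q\<^sup>2" for p q :: real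
    using zero_le_power2[of "2 * p - q / 2"] by (simp add: power2_eq_square field_simps)
  have p4: "z^4 = (z\<^sup>2)\<^sup>2" for z :: real by simp
  have "(x + y)^4 = ((x + y)\<^sup>2)\<^sup>2" by (rule p4)
  also have "\<dots> \<le> (5 * x\<^sup>2 + (5/4) * y\<^sup>2)\<^sup>2"
    by (intro power_mono sq) simp
  also have "\<dots> \<le> 5 * (5 * x\<^sup>2)\<^sup>2 + (5/4) * ((5/4) * y\<^sup>2)\<^sup>2" by (rule sq)
  also have "\<dots> = 125 * x^4 + (125/64) * y^4"
    by (simp add: power_mult_distrib power_divide)
  finally show ?thesis .
qed

text \<open>Bisection with respect to the variance \<open>V\<close>: cut the index interval where \<open>V\<close> first
  gains half of its total increment \<open>h\<close>. Both remaining parts then have increment at most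
  \<open>h / 2\<close>, and the induction hypothesis for them costs \<open>2 K (h / 2)\<^sup>2 = K h\<^sup>2 / 2\<close>. The
  gain of the factor \<open>1/2\<close> (the exponent of the increment exceeds \<open>1\<close>) leaves room for the weight
  \<open>125/64 < 2\<close> and for the jump across the cut; \<open>K = 16000\<close> solves
  \<open>375 + (125/128) K \<le> K\<close>. The maximum itself is replaced by a dominating function, which makes
  its integral additive.\<close>

lemma maximal_fourth_moment:
  fixes S :: "nat \<Rightarrow> 'a \<Rightarrow> real" and V :: "nat \<Rightarrow> real"
  assumes [measurable]: "\<And>n. S n \<in> borel_measurable M"
    and V: "mono V"
    and mom: "\<And>i j. i \<le> j \<Longrightarrow>
      (\<integral>\<^sup>+x. ennreal ((S j x - S i x)^4) \<partial>M) \<le> ennreal (3 * (V j - V i)\<^sup>2)"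
  shows "i \<le> j \<Longrightarrow> \<exists>G. G \<in> borel_measurable M \<and> (\<forall>x. 0 \<le> (G x :: real)) \<and>
      (\<forall>k\<in>{i..j}. \<forall>x. (S k x - S i x)^4 \<le> G x) \<and>
      (\<integral>\<^sup>+x. ennreal (G x) \<partial>M) \<le> ennreal (16000 * (V j - V i)\<^sup>2)"
proof (induction "j - i" arbitrary: i j rule: less_induct)
  case less
  show ?case
  proof (cases "i = j")
    case True
    then show ?thesis by (intro exI[of _ "\<lambda>_. 0"]) auto
  next
    case False
    with less.prems have ij: "i < j" by simp
    define h where "h = V j - V i"
    have h: "0 \<le> h" using monoD[OF V less.prems] by (simp add: h_def)
    define P where "P k \<longleftrightarrow> i < k \<and> h / 2 \<le> V k - V i" for k
    define c where "c = (LEAST k. P k)"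
    have "P j" using ij h by (simp add: P_def h_def)
    then have Pc: "P c" and cj: "c \<le> j" unfolding c_def by (auto intro: LeastI Least_le)
    have ic: "i < c" using Pc by (simp add: P_def)
    obtain m where m: "c = Suc m" using ic by (cases c) auto
    have im: "i \<le> m" using ic m by simp
    have hm: "V m - V i \<le> h / 2"
    proof (cases "i = m")
      case True then show ?thesis using h by simp
    next
      case False
      have "\<not> P m" unfolding c_def by (rule not_less_Least) (use m in \<open>simp add: c_def\<close>)
      with False im show ?thesis by (auto simp: P_def)
    qed
    have hc: "V j - V c \<le> h / 2" using Pc by (simp add: P_def h_def)
    have V0: "0 \<le> V m - V i" "0 \<le> V j - V c" "0 \<le> V c - V i" "V c - V i \<le> h"
      using monoD[OF V] im cj ic by (auto simp: h_def)
    obtain G1 where G1[measurable]: "G1 \<in> borel_measurable M" and G1n: "\<And>x. 0 \<le> G1 x"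
      and G1b: "\<And>k x. k \<in> {i..m} \<Longrightarrow> (S k x - S i x)^4 \<le> G1 x"
      and G1i: "(\<integral>\<^sup>+x. ennreal (G1 x) \<partial>M) \<le> ennreal (16000 * (V m - V i)\<^sup>2)"
      using less.hyps[of m i] im cj ij m by fastforce
    obtain G2 where G2[measurable]: "G2 \<in> borel_measurable M" and G2n: "\<And>x. 0 \<le> G2 x"
      and G2b: "\<And>k x. k \<in> {c..j} \<Longrightarrow> (S k x - S c x)^4 \<le> G2 x"
      and G2i: "(\<integral>\<^sup>+x. ennreal (G2 x) \<partial>M) \<le> ennreal (16000 * (V j - V c)\<^sup>2)"
      using less.hyps[of j c] ic cj ij by fastforce
    define G where "G x = 125 * (S c x - S i x)^4 + (125/64) * (G1 x + G2 x)" for x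
    have "(S k x - S i x)^4 \<le> G x" if k: "k \<in> {i..j}" for k x
    proof (cases "k \<le> m")
      case True
      have "(S k x - S i x)^4 \<le> G1 x" using G1b True k by simp
      also have "\<dots> \<le> (125/64) * (G1 x + G2 x)" using G1n[of x] G2n[of x] by simp
      also have "\<dots> \<le> G x" by (simp add: G_def)
      finally show ?thesis .
    next
      case False
      have "(S k x - S i x)^4 = ((S c x - S i x) + (S k x - S c x))^4" by simp
      also have "\<dots> \<le> 125 * (S c x - S i x)^4 + (125/64) * (S k x - S c x)^4"
        by (rule fourth_power_add_le)
      also have "(S k x - S c x)^4 \<le> G2 x" using G2b False k m by simp
      also have "125 * (S c x - S i x)^4 + (125/64) * G2 x \<le> G x"
        using G1n[of x] by (simp add: G_def)
      finally show ?thesis by simp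
    qed
    moreover have "(\<integral>\<^sup>+x. ennreal (G x) \<partial>M) \<le> ennreal (16000 * (V j - V i)\<^sup>2)"
    proof -
      have comb: "ennreal (125 * p + (125/64) * (q + r)) =
          125 * ennreal p + ennreal (125/64) * (ennreal q + ennreal r)"
        if "0 \<le> p" "0 \<le> q" "0 \<le> r" for p q r :: real
      proof -
        have "ennreal (125 * p + (125/64) * (q + r)) = ennreal (125 * p) + ennreal ((125/64) * (q + r))"
          using that by (intro ennreal_plus) auto
        also have "ennreal (125 * p) = 125 * ennreal p"
          by (simp add: ennreal_mult')
        also have "ennreal ((125/64) * (q + r)) = ennreal (125/64) * ennreal (q + r)"
          by (rule ennreal_mult') simp
        also have "ennreal (q + r) = ennreal q + ennreal r"
          using that by (intro ennreal_plus)
        finally show ?thesis .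
      qed
      have "(\<integral>\<^sup>+x. ennreal (G x) \<partial>M) =
          (\<integral>\<^sup>+x. 125 * ennreal ((S c x - S i x)^4) + ennreal (125/64) * (ennreal (G1 x) + ennreal (G2 x)) \<partial>M)"
        unfolding G_def by (intro nn_integral_cong comb) (simp_all add: G1n G2n)
      also have "\<dots> = 125 * (\<integral>\<^sup>+x. ennreal ((S c x - S i x)^4) \<partial>M)
          + ennreal (125/64) * ((\<integral>\<^sup>+x. ennreal (G1 x) \<partial>M) + (\<integral>\<^sup>+x. ennreal (G2 x) \<partial>M))"
        by (simp add: nn_integral_add nn_integral_cmult)
      also have "\<dots> \<le> 125 * ennreal (3 * (V c - V i)\<^sup>2)
          + ennreal (125/64) * (ennreal (16000 * (V m - V i)\<^sup>2) + ennreal (16000 * (V j - V c)\<^sup>2))"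
        by (intro add_mono mult_left_mono mom G1i G2i) (use ic in auto)
      also have "\<dots> \<le> 125 * ennreal (3 * h\<^sup>2)
          + ennreal (125/64) * (ennreal (16000 * (h/2)\<^sup>2) + ennreal (16000 * (h/2)\<^sup>2))"
        by (intro add_mono mult_left_mono ennreal_leI power_mono hm hc V0) auto
      also have "\<dots> = ennreal (125 * (3 * h\<^sup>2) + (125/64) * (16000 * (h/2)\<^sup>2 + 16000 * (h/2)\<^sup>2))"
        by (rule comb[symmetric]) auto
      also have "\<dots> = ennreal (16000 * (V j - V i)\<^sup>2)"
        by (simp add: h_def power_divide)
      finally show ?thesis .
    qed
    moreover have "G \<in> borel_measurable M" unfolding G_def by measurable
    moreover have "0 \<le> G x" for x using G1n[of x] G2n[of x] by (simp add: G_def)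
    ultimately show ?thesis by blast
  qed
qed

text \<open>The oscillation of the tails of \<open>S\<close> has fourth moment \<open>O((lim V - V i)\<^sup>2)\<close>, which tends
  to \<open>0\<close>; hence the oscillation vanishes in the limit.\<close>

lemma AE_convergent_of_fourth_moments:
  fixes S :: "nat \<Rightarrow> 'a \<Rightarrow> real" and V :: "nat \<Rightarrow> real"
  assumes [measurable]: "\<And>n. S n \<in> borel_measurable M"
    and V: "mono V" and Vlim: "V \<longlonglongrightarrow> v"
    and mom: "\<And>i j. i \<le> j \<Longrightarrow>
      (\<integral>\<^sup>+x. ennreal ((S j x - S i x)^4) \<partial>M) \<le> ennreal (3 * (V j - V i)\<^sup>2)"
  shows "AE x in M. convergent (\<lambda>n. S n x)"
proof -
  define A where "A i j x = (SUP k\<in>{i..j}. ennreal ((S k x - S i x)^4))" for i j x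
  define D where "D i x = (SUP j. A i (i + j) x)" for i x
  have [measurable]: "A i j \<in> borel_measurable M" for i j unfolding A_def by measurable
  have [measurable]: "D i \<in> borel_measurable M" for i unfolding D_def by measurable
  have Ab: "(\<integral>\<^sup>+x. A i (i + j) x \<partial>M) \<le> ennreal (16000 * (v - V i)\<^sup>2)" for i j
  proof -
    have "\<exists>G. G \<in> borel_measurable M \<and> (\<forall>x. 0 \<le> (G x :: real)) \<and>
      (\<forall>k\<in>{i..i + j}. \<forall>x. (S k x - S i x)^4 \<le> G x) \<and>
      (\<integral>\<^sup>+x. ennreal (G x) \<partial>M) \<le> ennreal (16000 * (V (i + j) - V i)\<^sup>2)"
      by (rule maximal_fourth_moment[OF _ V mom]) auto
    then obtain G where G: "\<And>k x. k \<in> {i..i + j} \<Longrightarrow> (S k x - S i x)^4 \<le> G x"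
      "(\<integral>\<^sup>+x. ennreal (G x) \<partial>M) \<le> ennreal (16000 * (V (i + j) - V i)\<^sup>2)" by blast
    have "(\<integral>\<^sup>+x. A i (i + j) x \<partial>M) \<le> (\<integral>\<^sup>+x. ennreal (G x) \<partial>M)"
      unfolding A_def by (intro nn_integral_mono SUP_least ennreal_leI G(1))
    also note G(2)
    also have "ennreal (16000 * (V (i + j) - V i)\<^sup>2) \<le> ennreal (16000 * (v - V i)\<^sup>2)"
      using monoD[OF V, of i "i + j"] incseq_le[OF V Vlim, of "i + j"]
      by (intro ennreal_leI mult_left_mono power_mono) auto
    finally show ?thesis .
  qed
  have Db: "(\<integral>\<^sup>+x. D i x \<partial>M) \<le> ennreal (16000 * (v - V i)\<^sup>2)" for i
  proof -
    have "(\<integral>\<^sup>+x. D i x \<partial>M) = (SUP j. \<integral>\<^sup>+x. A i (i + j) x \<partial>M)"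
      unfolding D_def
      by (rule nn_integral_monotone_convergence_SUP)
        (auto simp: incseq_def le_fun_def A_def intro!: SUP_subset_mono)
    also have "\<dots> \<le> ennreal (16000 * (v - V i)\<^sup>2)" by (intro SUP_least Ab)
    finally show ?thesis .
  qed
  have "(\<integral>\<^sup>+x. (INF i. D i x) \<partial>M) \<le> ennreal (16000 * (v - V i)\<^sup>2)" for i
    by (rule order_trans[OF nn_integral_mono Db]) (auto intro: INF_lower)
  moreover have "(\<lambda>i. ennreal (16000 * (v - V i)\<^sup>2)) \<longlonglongrightarrow> ennreal (16000 * (v - v)\<^sup>2)"
    by (intro tendsto_ennrealI tendsto_intros Vlim)
  ultimately have "(\<integral>\<^sup>+x. (INF i. D i x) \<partial>M) \<le> 0"
    by (intro LIMSEQ_le_const[where X="\<lambda>i. ennreal (16000 * (v - V i)\<^sup>2)"]) auto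
  then have "AE x in M. (INF i. D i x) = 0"
    by (subst nn_integral_0_iff_AE[symmetric]) auto
  then show ?thesis
  proof eventually_elim
    case (elim x)
    have "Cauchy (\<lambda>n. S n x)"
    proof (rule metric_CauchyI)
      fix e :: real assume e: "0 < e"
      have "(INF i. D i x) < ennreal ((e/2)^4)" using elim e by simp
      then obtain i where i: "D i x < ennreal ((e/2)^4)" by (auto simp: INF_less_iff)
      have b: "\<bar>S k x - S i x\<bar> < e / 2" if "i \<le> k" for k
      proof -
        have "ennreal ((S k x - S i x)^4) \<le> A i k x"
          unfolding A_def using that by (intro SUP_upper) auto
        also have "A i k x \<le> D i x"
          unfolding D_def using that by (intro SUP_upper2[of "k - i"]) auto
        also note i
        finally have "\<bar>S k x - S i x\<bar>^4 < (e/2)^4" by (simp add: ennreal_less_iff)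
        then show ?thesis by (rule power_less_imp_less_base) (use e in simp)
      qed
      show "\<exists>N. \<forall>m\<ge>N. \<forall>n\<ge>N. dist (S m x) (S n x) < e"
      proof (intro exI[of _ i] allI impI)
        fix m n assume "i \<le> m" "i \<le> n"
        from b[OF this(1)] b[OF this(2)] show "dist (S m x) (S n x) < e"
          by (simp add: dist_real_def abs_if split: if_splits)
      qed
    qed
    then show ?case by (rule Cauchy_convergent)
  qed
qed

text \<open>Some subsequence converges almost surely to the limit in mean square, which identifies the almost
  sure limit.\<close>

lemma L2_tendsto_and_AE:
  assumes L2: "L2_tendsto M S Z" and conv: "AE x in M. convergent (\<lambda>n. S n x)"
  shows "tendsto_L2_and_AE M S Z"
proof -
  obtain r where r: "strict_mono r" "AE x in M. (\<lambda>n. S (r n) x) \<longlonglongrightarrow> Z x"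
    using L2_tendsto_AE_subseq[OF L2] .
  have "AE x in M. (\<lambda>n. S n x) \<longlonglongrightarrow> Z x"
    using conv r(2)
  proof eventually_elim
    case (elim x)
    then obtain l where l: "(\<lambda>n. S n x) \<longlonglongrightarrow> l" by (auto simp: convergent_def)
    from LIMSEQ_subseq_LIMSEQ[OF l r(1)] have "(\<lambda>n. S (r n) x) \<longlonglongrightarrow> l" by (simp add: comp_def)
    with elim(2) have "l = Z x" by (intro LIMSEQ_unique)
    with l show ?case by simp
  qed
  with L2 show ?thesis by (simp add: tendsto_L2_and_AE_def)
qed

section \<open>Closed linear classes of square-integrable functions\<close>

lemma L2_tendsto_dominated:
  assumes F: "\<And>n. F n \<in> borel_measurable M" and f: "f \<in> borel_measurable M"
    and w: "sq_integrable M w"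
    and bnd: "\<And>n x. x \<in> space M \<Longrightarrow> \<bar>F n x\<bar> \<le> w x"
    and lim: "AE x in M. (\<lambda>n. F n x) \<longlonglongrightarrow> f x"
    and fw: "\<And>x. x \<in> space M \<Longrightarrow> \<bar>f x\<bar> \<le> w x"
  shows "L2_tendsto M F f"
proof -
  note [measurable] = F f
  have wi: "integrable M (\<lambda>x. (w x)\<^sup>2)" using w by (simp add: sq_integrable_def)
  have sq: "sq_integrable M g" if [measurable]: "g \<in> borel_measurable M"
      and "\<And>x. x \<in> space M \<Longrightarrow> \<bar>g x\<bar> \<le> w x" for g
  proof -
    have "integrable M (\<lambda>x. (g x)\<^sup>2)"
    proof (rule Bochner_Integration.integrable_bound[OF wi])
      show "AE x in M. norm ((g x)\<^sup>2) \<le> norm ((w x)\<^sup>2)"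
      proof (rule AE_I2)
        fix x assume "x \<in> space M"
        from order_trans[OF that(2)[OF this] abs_ge_self]
        show "norm ((g x)\<^sup>2) \<le> norm ((w x)\<^sup>2)" by (simp add: abs_le_square_iff[symmetric])
      qed
    qed measurable
    then show ?thesis using that by (simp add: sq_integrable_def)
  qed
  have "(\<lambda>n. sqnorm M (\<lambda>x. F n x - f x)) \<longlonglongrightarrow> (LINT x|M. 0)"
  proof (rule integral_dominated_convergence[where w="\<lambda>x. 4 * (w x)\<^sup>2"])
    show "AE x in M. (\<lambda>n. (F n x - f x)\<^sup>2) \<longlonglongrightarrow> 0"
      using lim
    proof eventually_elim
      case (elim x)
      then have "(\<lambda>n. (F n x - f x)\<^sup>2) \<longlonglongrightarrow> (f x - f x)\<^sup>2" by (intro tendsto_intros)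
      then show ?case by simp
    qed
    show "AE x in M. norm ((F n x - f x)\<^sup>2) \<le> 4 * (w x)\<^sup>2" for n
    proof (rule AE_I2)
      fix x assume x: "x \<in> space M"
      have "\<bar>F n x - f x\<bar> \<le> 2 * w x" using bnd[OF x, of n] fw[OF x] by linarith
      then have "\<bar>F n x - f x\<bar>\<^sup>2 \<le> (2 * w x)\<^sup>2" by (intro power_mono) auto
      then show "norm ((F n x - f x)\<^sup>2) \<le> 4 * (w x)\<^sup>2" by (simp add: power_mult_distrib)
    qed
    show "integrable M (\<lambda>x. 4 * (w x)\<^sup>2)" using wi by simp
  qed measurable
  then show ?thesis
    unfolding L2_tendsto_def using sq[OF F bnd] sq[OF f fw] by simp
qed

text \<open>Induction on square-integrable functions: simple functions with \<open>\<bar>h i\<bar> \<le> 2 \<bar>f\<bar>\<close> converge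
  to \<open>f\<close> pointwise and hence in mean square, by domination.\<close>

lemma closed_linear_class_L2:
  assumes fin: "finite_measure M"
    and ind: "\<And>A. A \<in> sets M \<Longrightarrow> P (indicator A)"
    and lin: "\<And>f g c. P f \<Longrightarrow> P g \<Longrightarrow> P (\<lambda>x. f x + c * g x)"
    and lim: "\<And>F f. (\<And>n. P (F n)) \<Longrightarrow> L2_tendsto M F f \<Longrightarrow> P f"
    and f: "sq_integrable M f"
  shows "P (f :: 'a \<Rightarrow> real)"
proof -
  have [measurable]: "f \<in> borel_measurable M" using f by measurable
  have P0: "P (\<lambda>x. 0)"
    using ind[of "{}"] by (simp add: indicator_def[abs_def])
  have Psum: "P (\<lambda>x. \<Sum>y\<in>Y. y * indicator (B y) x)"
    if "\<And>y. y \<in> Y \<Longrightarrow> B y \<in> sets M" for Y :: "real set" and B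
    using that
  proof (induction Y rule: infinite_finite_induct)
    case (insert y Y)
    have "P (\<lambda>x. (\<Sum>y\<in>Y. y * indicator (B y) x) + y * indicator (B y) x)"
      by (intro lin ind insert) (use insert in auto)
    then show ?case by (simp only: sum.insert[OF insert.hyps] add.commute)
  qed (use P0 in auto)
  obtain s where s: "\<And>i. simple_function M (s i)"
      "\<And>x. x \<in> space M \<Longrightarrow> (\<lambda>i. s i x) \<longlonglongrightarrow> f x"
      "\<And>i x. x \<in> space M \<Longrightarrow> \<bar>s i x\<bar> \<le> 2 * \<bar>f x\<bar>"
    using borel_measurable_implies_sequence_metric[of f M 0] unfolding dist_real_def by force
  define h where "h i x = (\<Sum>y\<in>s i ` space M. y * indicator (s i -` {y} \<inter> space M) x)" for i x
  have hs: "h i x = s i x" if "x \<in> space M" for i x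
  proof -
    have "h i x = (\<Sum>y\<in>s i ` space M. if y = s i x then y else 0)"
      unfolding h_def using that by (intro sum.cong) (auto simp: indicator_def)
    then show ?thesis using s(1)[of i] that by (simp add: simple_function_def)
  qed
  have "P (h i)" for i
    unfolding h_def[abs_def] by (rule Psum) (use s(1)[of i] in \<open>auto intro: simple_functionD\<close>)
  moreover have "L2_tendsto M h f"
  proof (rule L2_tendsto_dominated[where w="\<lambda>x. 2 * \<bar>f x\<bar>"])
    show "h n \<in> borel_measurable M" for n
      using measurable_cong[of M "h n" "s n" borel] hs borel_measurable_simple_function[OF s(1)[of n]]
      by blast
    show "sq_integrable M (\<lambda>x. 2 * \<bar>f x\<bar>)"
      using f by (simp add: sq_integrable_def power_mult_distrib)
    show "AE x in M. (\<lambda>n. h n x) \<longlonglongrightarrow> f x" using s(2) by (intro AE_I2) (simp add: hs)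
  qed (use s(3) in \<open>auto simp: hs\<close>)
  ultimately show ?thesis by (rule lim)
qed

section \<open>Extending an isometric correspondence to closed spans\<close>

definition combination :: "('i \<Rightarrow> 'a \<Rightarrow> real) \<Rightarrow> (real \<times> 'i) list \<Rightarrow> 'a \<Rightarrow> real" where
  "combination e L x = (\<Sum>(c, s)\<leftarrow>L. c * e s x)"

lemma combination_simps [simp]:
  "combination e [] = (\<lambda>x. 0)"
  "combination e (p # L) = (\<lambda>x. fst p * e (snd p) x + combination e L x)"
  by (auto simp: combination_def fun_eq_iff split: prod.split)

lemma combination_append_scaled:
  "combination e (L @ map (\<lambda>(d, s). (c * d, s)) K) x = combination e L x + c * combination e K x"
proof (induction L)
  case Nil
  show ?case by (induction K) (auto simp: algebra_simps)
qed auto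

locale isometric_families =
  fixes S :: "'a measure" and M :: "'b measure"
    and e :: "'i \<Rightarrow> 'a \<Rightarrow> real" and y :: "'i \<Rightarrow> 'b \<Rightarrow> real" and T :: "'i set"
  assumes sq_e: "\<And>s. s \<in> T \<Longrightarrow> sq_integrable S (e s)"
    and sq_y: "\<And>s. s \<in> T \<Longrightarrow> sq_integrable M (y s)"
    and inner_eq: "\<And>s t. s \<in> T \<Longrightarrow> t \<in> T \<Longrightarrow>
      (LINT x|S. e s x * e t x) = (LINT x|M. y s x * y t x)"
begin

lemma sq_combination:
  assumes "snd ` set L \<subseteq> T"
  shows "sq_integrable S (combination e L)" "sq_integrable M (combination y L)"
  using assms
  by (induction L) (auto intro!: sq_integrable_zero sq_integrable_add sq_integrable_cmult sq_e sq_y)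

lemma inner_combination_single:
  assumes "snd ` set L \<subseteq> T" "s \<in> T"
  shows "(LINT x|S. e s x * combination e L x) = (LINT x|M. y s x * combination y L x)"
  using assms(1)
proof (induction L)
  case (Cons p L)
  then have p: "snd p \<in> T" and L: "snd ` set L \<subseteq> T" by auto
  have "(LINT x|S. e s x * combination e (p # L) x)
      = (LINT x|S. fst p * (e s x * e (snd p) x) + e s x * combination e L x)"
    by (intro Bochner_Integration.integral_cong) (auto simp: algebra_simps)
  also have "\<dots> = fst p * (LINT x|S. e s x * e (snd p) x) + (LINT x|S. e s x * combination e L x)"
    using sq_integrable_product[OF sq_e sq_e, OF assms(2) p]
      sq_integrable_product[OF sq_e sq_combination(1), OF assms(2) L] by simp
  also have "\<dots> = fst p * (LINT x|M. y s x * y (snd p) x) + (LINT x|M. y s x * combination y L x)"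
    using inner_eq[OF assms(2) p] Cons.IH[OF L] by simp
  also have "\<dots> = (LINT x|M. fst p * (y s x * y (snd p) x) + y s x * combination y L x)"
    using sq_integrable_product[OF sq_y sq_y, OF assms(2) p]
      sq_integrable_product[OF sq_y sq_combination(2), OF assms(2) L] by simp
  also have "\<dots> = (LINT x|M. y s x * combination y (p # L) x)"
    by (intro Bochner_Integration.integral_cong) (auto simp: algebra_simps)
  finally show ?case .
qed simp

lemma inner_combination:
  assumes "snd ` set K \<subseteq> T" "snd ` set L \<subseteq> T"
  shows "(LINT x|S. combination e K x * combination e L x)
       = (LINT x|M. combination y K x * combination y L x)"
  using assms(1)
proof (induction K)
  case (Cons p K)
  then have p: "snd p \<in> T" and K: "snd ` set K \<subseteq> T" by auto
  have "(LINT x|S. combination e (p # K) x * combination e L x)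
      = (LINT x|S. fst p * (e (snd p) x * combination e L x) + combination e K x * combination e L x)"
    by (intro Bochner_Integration.integral_cong) (auto simp: algebra_simps)
  also have "\<dots> = fst p * (LINT x|S. e (snd p) x * combination e L x)
      + (LINT x|S. combination e K x * combination e L x)"
    using sq_integrable_product[OF sq_e sq_combination(1), OF p assms(2)]
      sq_integrable_product[OF sq_combination(1) sq_combination(1), OF K assms(2)] by simp
  also have "\<dots> = fst p * (LINT x|M. y (snd p) x * combination y L x)
      + (LINT x|M. combination y K x * combination y L x)"
    using inner_combination_single[OF assms(2) p] Cons.IH[OF K] by simp
  also have "\<dots> = (LINT x|M. fst p * (y (snd p) x * combination y L x) + combination y K x * combination y L x)"
    using sq_integrable_product[OF sq_y sq_combination(2), OF p assms(2)]
      sq_integrable_product[OF sq_combination(2) sq_combination(2), OF K assms(2)] by simp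
  also have "\<dots> = (LINT x|M. combination y (p # K) x * combination y L x)"
    by (intro Bochner_Integration.integral_cong) (auto simp: algebra_simps)
  finally show ?case .
qed simp

text \<open>The graph of the extended isometry, as the closure of the graph on finite linear
  combinations. Working with a relation avoids choosing representatives and proving that they are
  compatible with sums.\<close>

definition corresponds :: "('a \<Rightarrow> real) \<Rightarrow> ('b \<Rightarrow> real) \<Rightarrow> bool" where
  "corresponds f Z \<longleftrightarrow> sq_integrable S f \<and> sq_integrable M Z \<and>
     (\<forall>\<epsilon>>0. \<exists>L. snd ` set L \<subseteq> T \<and> sqnorm S (\<lambda>x. f x - combination e L x) < \<epsilon> \<and>
        sqnorm M (\<lambda>x. Z x - combination y L x) < \<epsilon>)"

lemma correspondsD: "corresponds f Z \<Longrightarrow> sq_integrable S f" "corresponds f Z \<Longrightarrow> sq_integrable M Z"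
  by (auto simp: corresponds_def)

lemma corresponds_approx:
  assumes "corresponds f Z"
  obtains L where "\<And>k. snd ` set (L k) \<subseteq> T"
    "L2_tendsto S (\<lambda>k. combination e (L k)) f" "L2_tendsto M (\<lambda>k. combination y (L k)) Z"
proof -
  have "\<exists>L. snd ` set L \<subseteq> T \<and> sqnorm S (\<lambda>x. f x - combination e L x) < 1 / real (Suc k) \<and>
        sqnorm M (\<lambda>x. Z x - combination y L x) < 1 / real (Suc k)" for k
    using assms unfolding corresponds_def by simp
  then have "\<exists>L. \<forall>k. snd ` set (L k) \<subseteq> T \<and>
      sqnorm S (\<lambda>x. f x - combination e (L k) x) < 1 / real (Suc k) \<and>
      sqnorm M (\<lambda>x. Z x - combination y (L k) x) < 1 / real (Suc k)"
    by (intro choice) blast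
  then obtain L where L: "\<And>k. snd ` set (L k) \<subseteq> T"
    "\<And>k. sqnorm S (\<lambda>x. f x - combination e (L k) x) < 1 / real (Suc k)"
    "\<And>k. sqnorm M (\<lambda>x. Z x - combination y (L k) x) < 1 / real (Suc k)" by blast
  have lim: "(\<lambda>k. 1 / real (Suc k)) \<longlonglongrightarrow> 0" by (rule lim_1_over_n[THEN LIMSEQ_Suc])
  show ?thesis
  proof (rule that[OF L(1)])
    show "L2_tendsto S (\<lambda>k. combination e (L k)) f"
      by (intro L2_tendstoI[OF _ _ _ lim] sq_combination L(1) correspondsD[OF assms])
        (subst sqnorm_commute, rule less_imp_le, rule L(2))
    show "L2_tendsto M (\<lambda>k. combination y (L k)) Z"
      by (intro L2_tendstoI[OF _ _ _ lim] sq_combination L(1) correspondsD[OF assms])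
        (subst sqnorm_commute, rule less_imp_le, rule L(3))
  qed
qed

lemma corresponds_sqnorm:
  assumes "corresponds f Z"
  shows "sqnorm S f = sqnorm M Z"
proof -
  obtain L where L: "\<And>k. snd ` set (L k) \<subseteq> T"
    "L2_tendsto S (\<lambda>k. combination e (L k)) f" "L2_tendsto M (\<lambda>k. combination y (L k)) Z"
    using corresponds_approx[OF assms] by blast
  have "sqnorm S (combination e (L k)) = sqnorm M (combination y (L k))" for k
    using inner_combination[OF L(1) L(1)] by (simp add: power2_eq_square)
  with sqnorm_tendsto[OF L(2)] sqnorm_tendsto[OF L(3)] show ?thesis
    by (auto intro: LIMSEQ_unique)
qed

lemma corresponds_lincomb:
  assumes fZ: "corresponds f Z" and gW: "corresponds g W"
  shows "corresponds (\<lambda>x. f x + c * g x) (\<lambda>x. Z x + c * W x)"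
  unfolding corresponds_def
proof (intro conjI allI impI)
  note sq = correspondsD[OF fZ] correspondsD[OF gW]
  show "sq_integrable S (\<lambda>x. f x + c * g x)" "sq_integrable M (\<lambda>x. Z x + c * W x)"
    using sq by (auto intro: sq_integrable_add sq_integrable_cmult)
  fix \<epsilon> :: real assume \<epsilon>: "0 < \<epsilon>"
  have c0: "0 < 2 + 2 * c\<^sup>2" using zero_le_power2[of c] by linarith
  define d where "d = \<epsilon> / (2 + 2 * c\<^sup>2)"
  have d: "0 < d" using \<epsilon> c0 by (simp add: d_def)
  obtain L where L: "snd ` set L \<subseteq> T" "sqnorm S (\<lambda>x. f x - combination e L x) < d"
      "sqnorm M (\<lambda>x. Z x - combination y L x) < d"
    using fZ d unfolding corresponds_def by blast
  obtain K where K: "snd ` set K \<subseteq> T" "sqnorm S (\<lambda>x. g x - combination e K x) < d"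
      "sqnorm M (\<lambda>x. W x - combination y K x) < d"
    using gW d unfolding corresponds_def by blast
  define J where "J = L @ map (\<lambda>(d, s). (c * d, s)) K"
  have bound: "sqnorm N (\<lambda>x. (u x + c * v x) - combination b J x) < \<epsilon>"
    if "sq_integrable N u" "sq_integrable N v" "sq_integrable N (combination b L)"
      "sq_integrable N (combination b K)" "sqnorm N (\<lambda>x. u x - combination b L x) < d"
      "sqnorm N (\<lambda>x. v x - combination b K x) < d"
    for N :: "'x measure" and u v b
  proof -
    have "sqnorm N (\<lambda>x. (u x + c * v x) - combination b J x)
        = sqnorm N (\<lambda>x. (u x - combination b L x) + c * (v x - combination b K x))"
      unfolding J_def combination_append_scaled by (simp add: algebra_simps)
    also have "\<dots> \<le> 2 * sqnorm N (\<lambda>x. u x - combination b L x)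
        + 2 * sqnorm N (\<lambda>x. c * (v x - combination b K x))"
      using that by (intro sqnorm_add_le sq_integrable_diff sq_integrable_cmult)
    also have "\<dots> = 2 * sqnorm N (\<lambda>x. u x - combination b L x)
        + (2 * c\<^sup>2) * sqnorm N (\<lambda>x. v x - combination b K x)"
      by (simp add: sqnorm_cmult)
    also have "\<dots> < 2 * d + (2 * c\<^sup>2) * d"
      using that by (intro add_less_le_mono mult_left_mono) auto
    also have "\<dots> = (2 + 2 * c\<^sup>2) * d" by (simp add: algebra_simps)
    also have "\<dots> = \<epsilon>" using c0 by (simp add: d_def)
    finally show ?thesis .
  qed
  have "snd ` set J \<subseteq> T" using L K by (auto simp: J_def)
  moreover have "sqnorm S (\<lambda>x. (f x + c * g x) - combination e J x) < \<epsilon>"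
    by (intro bound sq_combination sq L K)
  moreover have "sqnorm M (\<lambda>x. (Z x + c * W x) - combination y J x) < \<epsilon>"
    by (intro bound sq_combination sq L K)
  ultimately show "\<exists>L. snd ` set L \<subseteq> T
      \<and> sqnorm S (\<lambda>x. f x + c * g x - combination e L x) < \<epsilon>
      \<and> sqnorm M (\<lambda>x. Z x + c * W x - combination y L x) < \<epsilon>"
    by blast
qed

lemma corresponds_zero: "corresponds (\<lambda>x. 0) (\<lambda>x. 0)"
  unfolding corresponds_def
  by (auto simp: sq_integrable_zero intro!: exI[of _ "[]"])

lemma corresponds_base:
  assumes "s \<in> T"
  shows "corresponds (e s) (y s)"
  unfolding corresponds_def using assms
  by (auto simp: sq_e sq_y intro!: exI[of _ "[(1, s)]"])

lemma corresponds_diff: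
  assumes "corresponds f Z" "corresponds g W"
  shows "corresponds (\<lambda>x. f x - g x) (\<lambda>x. Z x - W x)"
  using corresponds_lincomb[OF assms, of "-1"] by simp

lemma corresponds_sum:
  assumes "finite I" "\<And>i. i \<in> I \<Longrightarrow> corresponds (f i) (Z i)"
  shows "corresponds (\<lambda>x. \<Sum>i\<in>I. c i * f i x) (\<lambda>x. \<Sum>i\<in>I. c i * Z i x)"
  using assms
proof (induction I)
  case (insert i I)
  then have "corresponds (\<lambda>x. (\<Sum>i\<in>I. c i * f i x) + c i * f i x) (\<lambda>x. (\<Sum>i\<in>I. c i * Z i x) + c i * Z i x)"
    by (intro corresponds_lincomb) auto
  with insert.hyps show ?case by (simp add: add.commute)
qed (simp add: corresponds_zero)

lemma corresponds_closed:
  assumes FG: "\<And>n. corresponds (F n) (G n)" and f: "L2_tendsto S F f" and Z: "L2_tendsto M G Z"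
  shows "corresponds f Z"
  unfolding corresponds_def
proof (intro conjI allI impI)
  show sq: "sq_integrable S f" "sq_integrable M Z" using f Z by (auto simp: L2_tendsto_def)
  fix \<epsilon> :: real assume \<epsilon>: "0 < \<epsilon>"
  have "eventually (\<lambda>n. sqnorm S (\<lambda>x. F n x - f x) < \<epsilon> / 4) sequentially"
    "eventually (\<lambda>n. sqnorm M (\<lambda>x. G n x - Z x) < \<epsilon> / 4) sequentially"
    by (rule order_tendstoD(2)[of _ 0]; use f Z \<epsilon> in \<open>simp add: L2_tendsto_def\<close>)+
  then have "eventually (\<lambda>n. sqnorm S (\<lambda>x. F n x - f x) < \<epsilon> / 4 \<and>
      sqnorm M (\<lambda>x. G n x - Z x) < \<epsilon> / 4) sequentially" by (rule eventually_conj)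
  then obtain n where n: "sqnorm S (\<lambda>x. F n x - f x) < \<epsilon> / 4" "sqnorm M (\<lambda>x. G n x - Z x) < \<epsilon> / 4"
    by (auto simp: eventually_sequentially)
  obtain L where L: "snd ` set L \<subseteq> T" "sqnorm S (\<lambda>x. F n x - combination e L x) < \<epsilon> / 4"
      "sqnorm M (\<lambda>x. G n x - combination y L x) < \<epsilon> / 4"
    using FG[of n] \<epsilon> unfolding corresponds_def by (meson zero_less_divide_iff zero_less_numeral)
  have "sqnorm S (\<lambda>x. f x - combination e L x) < \<epsilon>"
    using sqnorm_diff_triangle[OF sq(1) correspondsD(1)[OF FG[of n]] sq_combination(1)[OF L(1)]]
      n(1) L(2) sqnorm_commute[of S f "F n"] by linarith
  moreover have "sqnorm M (\<lambda>x. Z x - combination y L x) < \<epsilon>"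
    using sqnorm_diff_triangle[OF sq(2) correspondsD(2)[OF FG[of n]] sq_combination(2)[OF L(1)]]
      n(2) L(3) sqnorm_commute[of M Z "G n"] by linarith
  ultimately show "\<exists>L. snd ` set L \<subseteq> T \<and> sqnorm S (\<lambda>x. f x - combination e L x) < \<epsilon> \<and>
        sqnorm M (\<lambda>x. Z x - combination y L x) < \<epsilon>"
    using L(1) by blast
qed

text \<open>Isometry transports the Cauchy property from the approximants to their images, so the domain
  of the correspondence is closed.\<close>

lemma corresponds_domain_closed:
  assumes F: "\<And>n. \<exists>Z. corresponds (F n) Z" and f: "L2_tendsto S F f"
  shows "\<exists>Z. corresponds f Z"
proof -
  obtain G where G: "\<And>n. corresponds (F n) (G n)" using F by metis
  have sq: "\<And>n. sq_integrable S (F n)" "sq_integrable S f"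
    and lim: "(\<lambda>n. sqnorm S (\<lambda>x. F n x - f x)) \<longlonglongrightarrow> 0"
    using f by (auto simp: L2_tendsto_def)
  define q where "q n = sqnorm S (\<lambda>x. F n x - f x)" for n
  have q0: "0 \<le> q n" for n by (simp add: q_def)
  have ex: "\<exists>N. \<forall>n\<ge>N. q n < (1/2)^k" for k :: nat
    using order_tendstoD(2)[OF lim, of "(1/2)^k"] by (auto simp: eventually_sequentially q_def)
  then obtain N where N: "\<And>k n. N k \<le> n \<Longrightarrow> q n < (1/2)^k" by metis
  have "sqnorm M (\<lambda>x. G (N m) x - G (N n) x) \<le> 4 * (1/2)^m" if "m \<le> n" for m n
  proof -
    have "sqnorm M (\<lambda>x. G (N m) x - G (N n) x) = sqnorm S (\<lambda>x. F (N m) x - F (N n) x)"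
      by (rule corresponds_sqnorm[OF corresponds_diff[OF G G], symmetric])
    also have "\<dots> \<le> 2 * q (N m) + 2 * q (N n)"
      using sqnorm_diff_triangle[OF sq(1) sq(2) sq(1), of "N m" "N n"]
        sqnorm_commute[of S f "F (N n)"] by (simp add: q_def)
    also have "\<dots> \<le> 2 * (1/2)^m + 2 * (1/2)^n"
      using N[of m "N m"] N[of n "N n"] by simp
    also have "\<dots> \<le> 4 * (1/2)^m"
      using power_decreasing[OF that, of "1/2::real"] by simp
    finally show ?thesis .
  qed
  moreover have "(\<lambda>m. 4 * (1/2)^m :: real) \<longlonglongrightarrow> 4 * 0"
    by (intro tendsto_intros LIMSEQ_power_zero) simp
  ultimately obtain Z where Z: "L2_tendsto M (\<lambda>m. G (N m)) Z"
    using L2_complete[of M "\<lambda>m. G (N m)" "\<lambda>m. 4 * (1/2)^m"] correspondsD(2)[OF G] by auto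
  have "L2_tendsto S (\<lambda>m. F (N m)) f"
  proof (rule L2_tendstoI[where u="\<lambda>m. (1/2)^m"])
    show "sqnorm S (\<lambda>x. F (N n) x - f x) \<le> (1/2)^n" for n
      using N[of n "N n"] by (simp add: q_def)
    show "(\<lambda>m. (1/2)^m :: real) \<longlonglongrightarrow> 0" by (rule LIMSEQ_power_zero) simp
  qed (fact sq)+
  then have "corresponds f Z"
    by (rule corresponds_closed[of "\<lambda>m. F (N m)" "\<lambda>m. G (N m)", OF G _ Z])
  then show ?thesis by blast
qed

end

section \<open>Step functions and the Stieltjes measure\<close>

lemma partition_mono:
  assumes "is_partition a b n \<tau>" "i \<le> j" "j \<le> n"
  shows "\<tau> i \<le> \<tau> j"
  using assms(2,3)
proof (induction j rule: dec_induct)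
  case (step j)
  then show ?case using assms(1) unfolding is_partition_def by (force dest: spec[of _ j])
qed simp

lemma partition_in_interval:
  assumes "is_partition a b n \<tau>" "i \<le> n"
  shows "\<tau> i \<in> {a..b}"
  using partition_mono[OF assms(1), of 0 i] partition_mono[OF assms(1), of i n] assms
  by (simp add: is_partition_def)

lemma step_fun_cell:
  assumes p: "is_partition a b n \<tau>" and i: "i < n" "\<tau> i \<le> x" "x < \<tau> (Suc i)"
  shows "step_fun n \<tau> c x = c i"
proof -
  have "x \<notin> {\<tau> j..<\<tau> (Suc j)}" if "j < n" "j \<noteq> i" for j
  proof (cases "j < i")
    case True
    then have "\<tau> (Suc j) \<le> \<tau> i" using i by (intro partition_mono[OF p]) auto
    then show ?thesis using i by auto
  next
    case False
    then have "\<tau> (Suc i) \<le> \<tau> j" using that by (intro partition_mono[OF p]) auto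
    then show ?thesis using i by auto
  qed
  then have "step_fun n \<tau> c x = (\<Sum>j<n. if j = i then c j else 0)"
    unfolding step_fun_def using i by (intro sum.cong) (auto simp: indicator_def)
  then show ?thesis using i by simp
qed

lemma step_fun_outside:
  assumes p: "is_partition a b n \<tau>" and x: "x \<notin> {a..<b}"
  shows "step_fun n \<tau> c x = 0"
proof -
  have "x \<notin> {\<tau> j..<\<tau> (Suc j)}" if "j < n" for j
    using partition_in_interval[OF p, of j] partition_in_interval[OF p, of "Suc j"] x that by auto
  then show ?thesis unfolding step_fun_def by (intro sum.neutral) auto
qed

lemma partition_of_finite_set:
  fixes a b :: real
  assumes "a < b" "finite Q" "Q \<subseteq> {a..b}" "a \<in> Q" "b \<in> Q"
  obtains n \<tau> where "is_partition a b n \<tau>" "\<tau> ` {..n} = Q"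
proof -
  define xs where "xs = sorted_list_of_set Q"
  have xs: "set xs = Q" "sorted_wrt (<) xs" using assms by (auto simp: xs_def)
  have "xs \<noteq> []" using xs(1) assms(4) by auto
  then obtain n where n: "length xs = Suc n" by (cases xs) auto
  have lt: "xs ! i < xs ! j" if "i < j" "j \<le> n" for i j
    using sorted_wrt_nth_less[OF xs(2), of i j] that n by simp
  have img: "(\<lambda>i. xs ! i) ` {..n} = Q"
    using xs(1) n by (auto simp: set_conv_nth less_Suc_eq_le) 
  have "xs ! 0 = a"
  proof -
    obtain i where i: "i \<le> n" "xs ! i = a" using img assms(4) by (metis atMost_iff imageE)
    have "a \<le> xs ! 0" using img assms(3) by auto
    then show ?thesis using lt[of 0 i] i by (cases "i = 0") auto
  qed
  moreover have "xs ! n = b"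
  proof -
    obtain i where i: "i \<le> n" "xs ! i = b" using img assms(5) by (metis atMost_iff imageE)
    have "xs ! n \<le> b" using img assms(3) by auto
    then show ?thesis using lt[of i n] i by (cases "i = n") auto
  qed
  ultimately have "is_partition a b n (\<lambda>i. xs ! i)"
    using lt by (auto simp: is_partition_def)
  then show thesis using img by (rule that)
qed

text \<open>The endpoints occurring in a combination, together with \<open>a\<close> and \<open>b\<close>, form a partition on whose cells
  the combination is constant. Thus combinations of the intervals \<open>[a, s)\<close>, which can be added
  without forming common refinements, give nothing but step functions.\<close>

lemma combination_is_step_fun:
  fixes a b :: real
  assumes ab: "a < b" and L: "snd ` set L \<subseteq> {a..b}"
  shows "\<exists>n \<tau> c. is_partition a b n \<tau> \<and> combination (\<lambda>s. indicator {a..<s}) L = step_fun n \<tau> c"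
proof -
  define Q where "Q = insert a (insert b (snd ` set L))"
  have "finite Q" "Q \<subseteq> {a..b}" "a \<in> Q" "b \<in> Q" using L ab by (auto simp: Q_def)
  from partition_of_finite_set[OF ab this]
  obtain n \<tau> where p: "is_partition a b n \<tau>" and img: "\<tau> ` {..n} = Q" .
  define c where "c i = combination (\<lambda>s. indicator {a..<s}) L (\<tau> i)" for i
  have same: "combination (\<lambda>s. indicator {a..<s}) L x = combination (\<lambda>s. indicator {a..<s}) L z"
    if "\<And>s. s \<in> snd ` set L \<Longrightarrow> x \<in> {a..<s} \<longleftrightarrow> z \<in> {a..<s}" for x z
    unfolding combination_def
  proof (intro arg_cong[where f=sum_list] map_cong refl)
    fix q assume "q \<in> set L"
    then have "x \<in> {a..<snd q} \<longleftrightarrow> z \<in> {a..<snd q}" by (intro that) auto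
    then show "(case q of (d, s) \<Rightarrow> d * indicator {a..<s} x) = (case q of (d, s) \<Rightarrow> d * indicator {a..<s} z)"
      by (auto simp: indicator_def split: prod.split)
  qed
  have zero: "combination (\<lambda>s. indicator {a..<s}) L b = 0"
    using L by (induction L) (auto simp: indicator_def)
  have "combination (\<lambda>s. indicator {a..<s}) L x = step_fun n \<tau> c x" for x
  proof (cases "x \<in> {a..<b}")
    case False
    have "combination (\<lambda>s. indicator {a..<s}) L x = combination (\<lambda>s. indicator {a..<s}) L b"
      using False L by (intro same) force
    then show ?thesis using zero step_fun_outside[OF p False] by simp
  next
    case True
    define i where "i = Max {i. i \<le> n \<and> \<tau> i \<le> x}"
    have fin: "finite {i. i \<le> n \<and> \<tau> i \<le> x}" by simp
    have "0 \<in> {i. i \<le> n \<and> \<tau> i \<le> x}" using True p by (simp add: is_partition_def)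
    then have "i \<in> {i. i \<le> n \<and> \<tau> i \<le> x}" unfolding i_def using fin by (intro Max_in) auto
    then have i: "i \<le> n" "\<tau> i \<le> x" by auto
    have "i \<noteq> n" using i True p by (auto simp: is_partition_def)
    then have "i < n" using i by simp
    have up: "x < \<tau> (Suc i)"
    proof (rule ccontr)
      assume "\<not> x < \<tau> (Suc i)"
      then have "Suc i \<le> i" unfolding i_def using fin \<open>i < n\<close> by (intro Max_ge) (auto simp: i_def)
      then show False by simp
    qed
    have "combination (\<lambda>s. indicator {a..<s}) L x = combination (\<lambda>s. indicator {a..<s}) L (\<tau> i)"
    proof (rule same)
      fix s assume "s \<in> snd ` set L"
      then have "s \<in> \<tau> ` {..n}" using img by (simp add: Q_def)
      then obtain k where k: "k \<le> n" "s = \<tau> k" by auto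
      have "x < s" if "\<tau> i < s"
      proof -
        have "i < k" using partition_mono[OF p, of k i] that k i by (cases "k \<le> i") auto
        then have "\<tau> (Suc i) \<le> \<tau> k" using k by (intro partition_mono[OF p]) auto
        then show ?thesis using up k by simp
      qed
      then show "x \<in> {a..<s} \<longleftrightarrow> \<tau> i \<in> {a..<s}"
        using i True partition_in_interval[OF p, of i] by auto
    qed
    then show ?thesis using step_fun_cell[OF p \<open>i < n\<close> i(2) up] by (simp add: c_def)
  qed
  with p show ?thesis by blast
qed

locale stieltjes =
  fixes a b :: real and \<rho> :: "real \<Rightarrow> real"
  assumes ab: "a < b" and cont: "continuous_on {a..b} \<rho>" and mono: "mono_on {a..b} \<rho>"
begin

abbreviation "S \<equiv> stieltjes_on a b \<rho>"

definition rho_ext :: "real \<Rightarrow> real" where "rho_ext x = \<rho> (max a (min x b))"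

definition S_borel :: "real measure" where "S_borel = restrict_space (interval_measure rho_ext) {a..b}"

lemma S_eq: "S = completion S_borel"
  by (simp add: stieltjes_on_def S_borel_def rho_ext_def[abs_def])

lemma rho_ext_mono: "x \<le> y \<Longrightarrow> rho_ext x \<le> rho_ext y"
  unfolding rho_ext_def using ab by (intro mono_onD[OF mono]) auto

lemma rho_ext_cont: "continuous_on UNIV rho_ext"
  unfolding rho_ext_def[abs_def]
  by (rule continuous_on_compose2[OF cont]) (use ab in \<open>auto intro!: continuous_intros\<close>)

lemma rho_ext_Icc: "x \<le> y \<Longrightarrow> emeasure (interval_measure rho_ext) {x..y} = ennreal (rho_ext y - rho_ext x)"
  by (rule emeasure_interval_measure_Icc[OF _ rho_ext_mono rho_ext_cont])

lemma space_S_borel [simp]: "space S_borel = {a..b}"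
  by (simp add: S_borel_def)

lemma space_S [simp]: "space S = {a..b}"
  by (simp add: S_eq)

lemma sets_S_borel: "sets S_borel = (\<lambda>B. {a..b} \<inter> B) ` sets borel"
  by (simp add: S_borel_def sets_restrict_space)

lemma finite_S: "finite_measure S"
proof
  have "emeasure S_borel {a..b} = ennreal (rho_ext b - rho_ext a)"
    unfolding S_borel_def using rho_ext_Icc[of a b] ab by (subst emeasure_restrict_space) auto
  moreover have "{a..b} \<in> sets S_borel" using sets.top[of S_borel] by simp
  ultimately show "emeasure S (space S) \<noteq> \<infinity>" by (simp add: S_eq)
qed

lemma measurable_S:
  assumes "f \<in> borel_measurable borel"
  shows "f \<in> borel_measurable S"
  unfolding S_eq S_borel_def
  by (intro measurable_completion measurable_restrict_space1) (use assms in simp)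

text \<open>Continuity of \<open>\<rho>\<close> makes points null sets, so that half-open and closed intervals may be
  exchanged.\<close>

lemma AE_S_neq: "AE x in S. x \<noteq> s"
proof -
  have "AE x in interval_measure rho_ext. x \<noteq> s"
    using rho_ext_Icc[of s s] by (intro AE_not_in[of "{s}", simplified]) (simp add: null_sets_def)
  then have "AE x in S_borel. x \<noteq> s"
    unfolding S_borel_def by (subst AE_restrict_space_iff) (auto elim: eventually_mono)
  then show ?thesis unfolding S_eq by (rule AE_completion)
qed

lemma integral_indicator_S:
  assumes s: "s \<in> {a..b}"
  shows "(LINT x|S. indicator {a..<s} x) = \<rho> s - \<rho> a"
proof -
  have "(LINT x|S. indicator {a..<s} x) = (LINT x|S. indicator {a..s} x :: real)"
  proof (rule integral_cong_AE)
    show "AE x in S. indicator {a..<s} x = (indicator {a..s} x :: real)"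
      using AE_S_neq[of s] by eventually_elim (auto simp: indicator_def)
  qed (rule measurable_S, measurable)+
  also have "\<dots> = measure S {a..s}"
  proof -
    have "{a..s} \<subseteq> space S" using s by auto
    then show ?thesis using s by (simp add: min_absorb1)
  qed
  also have "\<dots> = measure S_borel {a..s}"
  proof -
    have "{a..s} \<in> sets S_borel" unfolding sets_S_borel using s by (intro image_eqI[of _ _ "{a..s}"]) auto
    then show ?thesis by (simp add: S_eq)
  qed
  also have "\<dots> = measure (interval_measure rho_ext) {a..s}"
    unfolding S_borel_def using s by (subst measure_restrict_space) auto
  also have "\<dots> = rho_ext s - rho_ext a"
    using rho_ext_Icc[of a s] rho_ext_mono[of a s] s by (simp add: measure_def)
  also have "\<dots> = \<rho> s - \<rho> a" using s ab by (simp add: rho_ext_def max_def min_def)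
  finally show ?thesis .
qed

lemma sq_integrable_indicator_S: "sq_integrable S (indicator {a..<s})"
  by (rule sq_integrable_bounded[OF finite_S measurable_S, of _ 1]) (auto simp: indicator_def)

text \<open>The intervals \<open>[a, s)\<close> generate the Borel sets of \<open>[a, b]\<close> and are stable under
  intersection, so Dynkin's lemma applies to the sets whose indicators lie in the class.\<close>

lemma closed_linear_class_of_intervals:
  assumes base: "\<And>s. s \<in> {a..b} \<Longrightarrow> P (indicator {a..<s} :: real \<Rightarrow> real)"
    and lin: "\<And>f g c. P f \<Longrightarrow> P g \<Longrightarrow> P (\<lambda>x. f x + c * g x)"
    and lim: "\<And>F f. (\<And>n. P (F n)) \<Longrightarrow> L2_tendsto S F f \<Longrightarrow> P f"
    and f: "sq_integrable S f"
  shows "P f"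
proof (rule closed_linear_class_L2[where P=P, OF finite_S _ lin lim f])
  interpret finite_measure S by (rule finite_S)
  have ae: "P g" if "P h" "sq_integrable S h" "sq_integrable S g" "AE x in S. h x = g x" for g h
  proof (rule lim)
    have "sqnorm S (\<lambda>x. h x - g x) = sqnorm S (\<lambda>x. 0)"
      using that(4) by (intro sqnorm_cong_AE sq_integrable_diff sq_integrable_zero that) auto
    then show "L2_tendsto S (\<lambda>_. h) g"
      unfolding L2_tendsto_def using that by simp
  qed (rule that(1))
  have sq_ind: "sq_integrable S (indicator A)" if "A \<in> sets S" for A
    using that by (intro sq_integrable_bounded[OF finite_S, of _ 1]) (auto simp: indicator_def)
  have setS: "B \<inter> {a..b} \<in> sets S" if "B \<in> sets borel" for B
    unfolding S_eq using that by (intro sets_completionI_sets) (auto simp: sets_S_borel)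
  have top: "P (indicator {a..b})"
  proof (rule ae[OF base[of b]])
    show "AE x in S. indicator {a..<b} x = (indicator {a..b} x :: real)"
      using AE_S_neq[of b] by eventually_elim (auto simp: indicator_def)
    show "sq_integrable S (indicator {a..b})"
      using setS[of UNIV] by (intro sq_ind) simp
  qed (use ab sq_integrable_indicator_S in auto)
  have zero: "P (\<lambda>x. 0)" using base[of a] ab by (simp add: indicator_def[abs_def])
  have borel: "P (indicator (B \<inter> {a..b}))" if "B \<in> sets borel" for B
  proof -
    have gen: "sets (borel :: real measure) = sigma_sets UNIV (range lessThan)"
      by (subst borel_Iio) simp
    have "{..<u} \<inter> {..<v} = {..<min u v}" for u v :: real by auto
    then have "Int_stable (range lessThan :: real set set)"
      by (auto simp: Int_stable_def)
    moreover have "range lessThan \<subseteq> Pow (UNIV :: real set)" by simp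
    moreover have "B \<in> sigma_sets UNIV (range lessThan)" using that gen by simp
    ultimately show ?thesis
    proof (induction rule: sigma_sets_induct_disjoint)
      case (basic A)
      then obtain s where A: "A = {..<s}" by auto
      consider "s < a" | "s \<in> {a..b}" | "b < s" by force
      then show ?case
      proof cases
        case 1
        then have "A \<inter> {a..b} = {}" by (auto simp: A)
        then show ?thesis using zero by (simp add: indicator_def[abs_def])
      next
        case 2
        then have "A \<inter> {a..b} = {a..<s}" by (auto simp: A)
        then show ?thesis using base[OF 2] by simp
      next
        case 3
        then have "A \<inter> {a..b} = {a..b}" by (auto simp: A)
        then show ?thesis using top by simp
      qed
    next
      case empty
      show ?case using zero by (simp add: indicator_def[abs_def])
    next
      case (compl A)
      have "P (\<lambda>x. indicator {a..b} x + (-1) * indicator (A \<inter> {a..b}) x)"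
        by (intro lin top compl.IH)
      moreover have "(\<lambda>x. indicator {a..b} x + (-1) * indicator (A \<inter> {a..b}) x)
          = (indicator ((UNIV - A) \<inter> {a..b}) :: real \<Rightarrow> real)"
        by (auto simp: indicator_def fun_eq_iff)
      ultimately show ?case by simp
    next
      case (union A)
      have Ab: "A i \<in> sets borel" for i using union.hyps(2) gen by auto
      have Psum: "P (\<lambda>x. \<Sum>i<n. indicator (A i \<inter> {a..b}) x)" for n
      proof (induction n)
        case (Suc n)
        have "P (\<lambda>x. (\<Sum>i<n. indicator (A i \<inter> {a..b}) x) + 1 * indicator (A n \<inter> {a..b}) x)"
          by (intro lin Suc union.IH)
        then show ?case by simp
      qed (simp add: zero)
      have sum_eq: "(\<Sum>i<n. indicator (A i \<inter> {a..b}) x) = (indicator ((\<Union>i<n. A i) \<inter> {a..b}) x :: real)"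
        for n x
      proof (induction n)
        case (Suc n)
        have "x \<in> A n \<Longrightarrow> i < n \<Longrightarrow> x \<notin> A i" for i
          using disjoint_family_onD[OF union.hyps(1), of i n] by auto
        then show ?case unfolding sum.lessThan_Suc Suc.IH
          by (auto simp: indicator_def less_Suc_eq)
      qed (simp add: indicator_def)
      have Un_n: "(\<Union>i<n. A i) \<inter> {a..b} \<in> sets S" for n using Ab by (intro setS) auto
      have Un: "(\<Union>i. A i) \<inter> {a..b} \<in> sets S" using Ab by (intro setS) auto
      show ?case
      proof (rule lim[OF Psum], rule L2_tendsto_dominated[where w="\<lambda>_. 1"])
        show "AE x in S. (\<lambda>n. \<Sum>i<n. indicator (A i \<inter> {a..b}) x)
            \<longlonglongrightarrow> (indicator ((\<Union>i. A i) \<inter> {a..b}) x :: real)"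
        proof (rule AE_I2)
          fix x
          have "eventually (\<lambda>n. indicator ((\<Union>i<n. A i) \<inter> {a..b}) x
              = (indicator ((\<Union>i. A i) \<inter> {a..b}) x :: real)) sequentially"
          proof (cases "\<exists>i. x \<in> A i")
            case True
            then obtain i where "x \<in> A i" by blast
            then show ?thesis
              by (intro eventually_sequentiallyI[of "Suc i"]) (force simp: indicator_def)
          qed (auto simp: indicator_def)
          then show "(\<lambda>n. \<Sum>i<n. indicator (A i \<inter> {a..b}) x)
            \<longlonglongrightarrow> (indicator ((\<Union>i. A i) \<inter> {a..b}) x :: real)"
            unfolding sum_eq by (rule tendsto_eventually)
        qed
        show "(\<lambda>x. \<Sum>i<n. indicator (A i \<inter> {a..b}) x :: real) \<in> borel_measurable S" for n
          unfolding sum_eq using Un_n[of n] by simp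
        show "indicator ((\<Union>i. A i) \<inter> {a..b}) \<in> borel_measurable S" using Un by simp
        show "sq_integrable S (\<lambda>_. 1)" by (simp add: sq_integrable_def)
        show "\<bar>\<Sum>i<n. indicator (A i \<inter> {a..b}) x\<bar> \<le> (1 :: real)" for n x
          unfolding sum_eq by (simp add: indicator_def)
      qed (auto simp: indicator_def)
    qed
  qed
  fix A assume A: "A \<in> sets S"
  then have A': "A \<in> sets (completion S_borel)" by (simp add: S_eq)
  have "main_part S_borel A \<in> sets S_borel" using A' by (rule main_part_sets)
  then obtain B where B: "B \<in> sets borel" "main_part S_borel A = B \<inter> {a..b}"
    by (auto simp: sets_S_borel)
  show "P (indicator A)"
  proof (rule ae[OF borel[OF B(1)]])
    have "AE x in S. x \<in> main_part S_borel A \<longleftrightarrow> x \<in> A"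
      unfolding S_eq by (rule AE_completion[OF AE_in_main_part[OF A']])
    then show "AE x in S. indicator (B \<inter> {a..b}) x = (indicator A x :: real)"
      by eventually_elim (simp add: B(2)[symmetric] indicator_def)
  qed (intro sq_ind setS B A)+
qed

end

section \<open>Gaussian fourth moments\<close>

lemma (in prob_space) centered_normal_moments:
  assumes \<sigma>: "0 < \<sigma>" and D: "distributed M lborel Z (normal_density 0 \<sigma>)"
  shows "(LINT x|M. (Z x)\<^sup>2) = \<sigma>\<^sup>2" "(\<integral>\<^sup>+x. ennreal ((Z x)^4) \<partial>M) = ennreal (3 * (\<sigma>\<^sup>2)\<^sup>2)"
proof -
  show "(LINT x|M. (Z x)\<^sup>2) = \<sigma>\<^sup>2"
    using integral_normal_moment_even[OF \<sigma>, of 0 1] distributed_integral[OF D, of "\<lambda>x. x\<^sup>2"]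
    by (simp add: eval_nat_numeral)
  have "has_bochner_integral lborel (\<lambda>x. normal_density 0 \<sigma> x * x^4) (3 * (\<sigma>\<^sup>2)\<^sup>2)"
    using normal_moment_even[OF \<sigma>, of 0 2] \<sigma> by (simp add: fact_numeral power_divide field_simps)
  then have "(\<integral>\<^sup>+x. ennreal (normal_density 0 \<sigma> x * x^4) \<partial>lborel) = ennreal (3 * (\<sigma>\<^sup>2)\<^sup>2)"
    by (subst nn_integral_eq_integral) (auto simp: has_bochner_integral_iff normal_density_nonneg)
  then have "(\<integral>\<^sup>+x. ennreal (normal_density 0 \<sigma> x) * ennreal (x^4) \<partial>lborel) = ennreal (3 * (\<sigma>\<^sup>2)\<^sup>2)"
    by (simp add: ennreal_mult normal_density_nonneg)
  then show "(\<integral>\<^sup>+x. ennreal ((Z x)^4) \<partial>M) = ennreal (3 * (\<sigma>\<^sup>2)\<^sup>2)"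
    by (subst distributed_nn_integral[OF D, symmetric]) auto
qed

section \<open>The Wiener integral of a Yeh process\<close>

locale yeh = stieltjes +
  fixes M :: "'w measure" and lam :: "real \<Rightarrow> real" and X :: "real \<Rightarrow> 'w \<Rightarrow> real"
  assumes yeh: "yeh_process M a b lam \<rho> X"
begin

abbreviation "Y \<equiv> centered lam X"

sublocale prob_space M
  using yeh unfolding yeh_process_def by blast

lemma sq_const: "sq_integrable M (\<lambda>_. c)"
  by (simp add: sq_integrable_def)

lemma sq_X: "t \<in> {a..b} \<Longrightarrow> sq_integrable M (X t)"
  using yeh unfolding yeh_process_def by blast

lemma sq_Y: "t \<in> {a..b} \<Longrightarrow> sq_integrable M (Y t)"
  using sq_integrable_diff[OF sq_X sq_const, of t "lam t"] by (simp add: centered_def[abs_def])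

lemma distributed_increment:
  assumes "a \<le> s" "s < t" "t \<le> b"
  shows "distributed M lborel (\<lambda>\<omega>. X t \<omega> - X s \<omega>)
          (\<lambda>x. ennreal (normal_density (lam t - lam s) (sqrt (\<rho> t - \<rho> s)) x))"
  using yeh assms unfolding yeh_process_def by blast

text \<open>The normal law of an increment is given by a density, and a normal density with standard deviation
  \<open>0\<close> vanishes identically, which is incompatible with total mass \<open>1\<close>.\<close>

lemma rho_strict:
  assumes "a \<le> s" "s < t" "t \<le> b"
  shows "\<rho> s < \<rho> t"
proof (rule ccontr)
  assume "\<not> \<rho> s < \<rho> t"
  moreover have "\<rho> s \<le> \<rho> t" using assms by (intro mono_onD[OF mono]) auto
  ultimately have "\<rho> t - \<rho> s = 0" by simp
  then have "(\<integral>\<^sup>+\<omega>. 1 \<partial>M) = (0 :: ennreal)"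
    using distributed_nn_integral[OF distributed_increment[OF assms], of "\<lambda>_. 1"]
    by (simp add: normal_density_def)
  then show False by (simp add: emeasure_space_1)
qed

lemma covariance_Y:
  assumes "a \<le> s" "s \<le> t" "t \<le> b"
  shows "(LINT \<omega>|M. Y s \<omega> * Y t \<omega>) = \<rho> s"
proof -
  have st: "s \<in> {a..b}" "t \<in> {a..b}" using assms by auto
  have int: "integrable M (X s)" "integrable M (X t)"
    using sq_integrable_product[OF sq_X sq_const[of 1]] st by auto
  have E: "(LINT \<omega>|M. X s \<omega>) = lam s" "(LINT \<omega>|M. X t \<omega>) = lam t"
    "(LINT \<omega>|M. X s \<omega> * X t \<omega>) = \<rho> s + lam s * lam t"
    using yeh assms st unfolding yeh_process_def by blast+
  have "(LINT \<omega>|M. Y s \<omega> * Y t \<omega>)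
     = (LINT \<omega>|M. X s \<omega> * X t \<omega> - lam t * X s \<omega> - lam s * X t \<omega> + lam s * lam t)"
    by (intro Bochner_Integration.integral_cong) (auto simp: centered_def algebra_simps)
  also have "\<dots> = \<rho> s"
    using int sq_integrable_product[OF sq_X sq_X, OF st] E by (simp add: prob_space)
  finally show ?thesis .
qed

definition incr :: "real \<Rightarrow> 'w \<Rightarrow> real" where "incr t \<omega> = Y t \<omega> - Y a \<omega>"

lemma sq_incr: "t \<in> {a..b} \<Longrightarrow> sq_integrable M (incr t)"
  unfolding incr_def[abs_def] using ab by (intro sq_integrable_diff sq_Y) auto

lemma covariance_incr:
  assumes "a \<le> s" "s \<le> t" "t \<le> b"
  shows "(LINT \<omega>|M. incr s \<omega> * incr t \<omega>) = \<rho> s - \<rho> a"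
proof -
  have in_ab: "a \<in> {a..b}" "s \<in> {a..b}" "t \<in> {a..b}" using assms ab by auto
  note int = sq_integrable_product[OF sq_Y sq_Y]
  have "(LINT \<omega>|M. incr s \<omega> * incr t \<omega>)
      = (LINT \<omega>|M. Y s \<omega> * Y t \<omega> - Y a \<omega> * Y s \<omega> - Y a \<omega> * Y t \<omega> + Y a \<omega> * Y a \<omega>)"
    by (intro Bochner_Integration.integral_cong) (auto simp: incr_def algebra_simps)
  also have "\<dots> = \<rho> s - \<rho> a"
    using int[of s t] int[of a s] int[of a t] int[of a a] in_ab assms
    by (simp add: covariance_Y)
  finally show ?thesis .
qed

text \<open>Both sides equal \<open>\<rho> (min s t) - \<rho> a\<close>: on the left this is the measure of \<open>[a, min s t)\<close>, on the
  right it is the covariance of the increments.\<close>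

sublocale isometric_families S M "\<lambda>s. indicator {a..<s}" incr "{a..b}"
proof
  fix s t assume st: "s \<in> {a..b}" "t \<in> {a..b}"
  have "(LINT x|S. indicator {a..<s} x * indicator {a..<t} x :: real)
      = (LINT x|S. indicator {a..<min s t} x)"
    by (intro Bochner_Integration.integral_cong) (auto simp: indicator_def)
  also have "\<dots> = \<rho> (min s t) - \<rho> a" using st by (intro integral_indicator_S) auto
  also have "\<dots> = (LINT \<omega>|M. incr s \<omega> * incr t \<omega>)"
    using covariance_incr[of s t] covariance_incr[of t s] st
    by (cases "s \<le> t") (auto simp: mult.commute)
  finally show "(LINT x|S. indicator {a..<s} x * indicator {a..<t} x)
      = (LINT \<omega>|M. incr s \<omega> * incr t \<omega>)" .
qed (use sq_integrable_indicator_S sq_incr in auto)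

lemma corresponds_step:
  assumes p: "is_partition a b n \<tau>"
  shows "corresponds (step_fun n \<tau> c) (step_integral Y n \<tau> c)"
proof -
  have "corresponds (\<lambda>x. \<Sum>i<n. c i * (indicator {a..<\<tau> (Suc i)} x - indicator {a..<\<tau> i} x))
     (\<lambda>\<omega>. \<Sum>i<n. c i * (incr (\<tau> (Suc i)) \<omega> - incr (\<tau> i) \<omega>))"
    by (intro corresponds_sum corresponds_diff corresponds_base partition_in_interval[OF p]) auto
  moreover have "(\<lambda>x. \<Sum>i<n. c i * (indicator {a..<\<tau> (Suc i)} x - indicator {a..<\<tau> i} x)) = step_fun n \<tau> c"
  proof
    fix x
    have "indicator {a..<\<tau> (Suc i)} x - indicator {a..<\<tau> i} x = (indicator {\<tau> i..<\<tau> (Suc i)} x :: real)"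
      if "i < n" for i
      using partition_in_interval[OF p, of i] partition_mono[OF p, of i "Suc i"] that
      by (auto simp: indicator_def)
    then show "(\<Sum>i<n. c i * (indicator {a..<\<tau> (Suc i)} x - indicator {a..<\<tau> i} x)) = step_fun n \<tau> c x"
      by (auto simp: step_fun_def intro!: sum.cong)
  qed
  moreover have "(\<lambda>\<omega>. \<Sum>i<n. c i * (incr (\<tau> (Suc i)) \<omega> - incr (\<tau> i) \<omega>)) = step_integral Y n \<tau> c"
    by (simp add: fun_eq_iff step_integral_def incr_def)
  ultimately show ?thesis by simp
qed

text \<open>The domain of the correspondence is a closed linear class containing the intervals.\<close>

lemma corresponds_exists:
  assumes "sq_integrable S f"
  shows "\<exists>Z. corresponds f Z"
proof (rule closed_linear_class_of_intervals[where P="\<lambda>f. \<exists>Z. corresponds f Z", OF _ _ _ assms])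
  show "\<exists>Z. corresponds (indicator {a..<s}) Z" if "s \<in> {a..b}" for s
    using corresponds_base[OF that] by blast
  show "\<exists>Z. corresponds (\<lambda>x. f x + c * g x) Z"
    if "\<exists>Z. corresponds f Z" "\<exists>Z. corresponds g Z" for f g c
    using that corresponds_lincomb by blast
  show "\<exists>Z. corresponds f Z" if "\<And>n. \<exists>Z. corresponds (F n) Z" "L2_tendsto S F f" for F f
    using that by (rule corresponds_domain_closed)
qed

lemma step_approximation:
  assumes "corresponds f Z"
  obtains n \<tau> c where "\<And>k. is_partition a b (n k) (\<tau> k)"
    "L2_tendsto S (\<lambda>k. step_fun (n k) (\<tau> k) (c k)) f"
proof (rule corresponds_approx[OF assms])
  fix L assume L: "\<And>k. snd ` set (L k) \<subseteq> {a..b}"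
    "L2_tendsto S (\<lambda>k. combination (\<lambda>s. indicator {a..<s}) (L k)) f"
  have "\<forall>k. \<exists>n \<tau> c. is_partition a b n \<tau> \<and>
      combination (\<lambda>s. indicator {a..<s}) (L k) = step_fun n \<tau> c"
    using combination_is_step_fun[OF ab L(1)] by blast
  then have "\<exists>n \<tau> c. \<forall>k. is_partition a b (n k) (\<tau> k) \<and>
      combination (\<lambda>s. indicator {a..<s}) (L k) = step_fun (n k) (\<tau> k) (c k)"
    by (simp only: choice_iff)
  then obtain n \<tau> c where "\<And>k. is_partition a b (n k) (\<tau> k)"
      "\<And>k. combination (\<lambda>s. indicator {a..<s}) (L k) = step_fun (n k) (\<tau> k) (c k)"
    by blast
  with L(2) show ?thesis by (intro that) auto
qed

text \<open>The isometry carries the distance between a step function and \<open>f\<close> to the distance between its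
  integral and \<open>Z\<close>, whichever sequence of step functions is used. This is what makes the Wiener
  integral well defined.\<close>

lemma corresponds_step_limit:
  assumes fZ: "corresponds f Z" and p: "\<And>k. is_partition a b (n k) (\<tau> k)"
    and lim: "L2_tendsto S (\<lambda>k. step_fun (n k) (\<tau> k) (c k)) f"
  shows "L2_tendsto M (\<lambda>k. step_integral Y (n k) (\<tau> k) (c k)) Z"
proof (rule L2_tendstoI)
  show "(\<lambda>k. sqnorm S (\<lambda>x. step_fun (n k) (\<tau> k) (c k) x - f x)) \<longlonglongrightarrow> 0"
    using lim by (simp add: L2_tendsto_def)
  show "sqnorm M (\<lambda>x. step_integral Y (n k) (\<tau> k) (c k) x - Z x)
      \<le> sqnorm S (\<lambda>x. step_fun (n k) (\<tau> k) (c k) x - f x)" for k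
    using corresponds_sqnorm[OF corresponds_diff[OF corresponds_step[OF p] fZ]] by simp
qed (use fZ p in \<open>auto intro: correspondsD corresponds_step\<close>)

text \<open>A partner \<open>Z\<close> of \<open>f\<close> witnesses that a Wiener integral exists, so the chosen representative has the
  defining property; applied to one sequence of step functions tending to \<open>f\<close>, this property places
  the representative in the closed graph.\<close>

lemma corresponds_wiener_integral:
  assumes "sq_integrable S f"
  shows "corresponds f (wiener_integral M a b \<rho> Y f)"
proof -
  obtain Z where Z: "corresponds f Z" using corresponds_exists[OF assms] by blast
  then have "is_wiener_integral M a b \<rho> Y f Z"
    unfolding is_wiener_integral_def using corresponds_step_limit[OF Z] correspondsD(2) by blast
  then have W: "is_wiener_integral M a b \<rho> Y f (wiener_integral M a b \<rho> Y f)"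
    unfolding wiener_integral_def by (rule someI[of "is_wiener_integral M a b \<rho> Y f"])
  obtain n \<tau> c where p: "\<And>k. is_partition a b (n k) (\<tau> k)"
    and lim: "L2_tendsto S (\<lambda>k. step_fun (n k) (\<tau> k) (c k)) f"
    using step_approximation[OF Z] by blast
  have "L2_tendsto M (\<lambda>k. step_integral Y (n k) (\<tau> k) (c k)) (wiener_integral M a b \<rho> Y f)"
    using W p lim unfolding is_wiener_integral_def by blast
  then show ?thesis
    by (rule corresponds_closed[OF corresponds_step[OF p] lim])
qed

text \<open>A step integral is a sum of independent centered normal variables, hence normal. Terms with
  coefficient \<open>0\<close> are removed first, since the sum rule for normal densities needs positive variances;
  if no term remains, the integral is \<open>0\<close>.\<close>

lemma step_fourth_moment:
  assumes p: "is_partition a b n \<tau>"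
  shows "(\<integral>\<^sup>+\<omega>. ennreal ((step_integral Y n \<tau> c \<omega>)^4) \<partial>M)
     \<le> ennreal (3 * (sqnorm M (step_integral Y n \<tau> c))\<^sup>2)"
proof -
  define I where "I = {i. i < n \<and> c i \<noteq> 0}"
  have finI: "finite I" by (simp add: I_def)
  define D where "D i \<omega> = X (\<tau> (Suc i)) \<omega> - X (\<tau> i) \<omega>" for i \<omega>
  define m where "m i = lam (\<tau> (Suc i)) - lam (\<tau> i)" for i
  define \<sigma> where "\<sigma> i = \<bar>c i\<bar> * sqrt (\<rho> (\<tau> (Suc i)) - \<rho> (\<tau> i))" for i
  have si: "step_integral Y n \<tau> c \<omega> = (\<Sum>i\<in>I. - c i * m i + c i * D i \<omega>)" for \<omega>
  proof -
    have "step_integral Y n \<tau> c \<omega> = (\<Sum>i<n. - c i * m i + c i * D i \<omega>)"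
      unfolding step_integral_def by (intro sum.cong) (auto simp: centered_def D_def m_def algebra_simps)
    also have "\<dots> = (\<Sum>i\<in>I. - c i * m i + c i * D i \<omega>)"
      by (rule sum.mono_neutral_right) (auto simp: I_def)
    finally show ?thesis .
  qed
  show ?thesis
  proof (cases "I = {}")
    case True
    then show ?thesis by (simp add: si)
  next
    case False
    have t: "a \<le> \<tau> i" "\<tau> i < \<tau> (Suc i)" "\<tau> (Suc i) \<le> b" if "i \<in> I" for i
      using that p partition_in_interval[OF p, of i] partition_in_interval[OF p, of "Suc i"]
      by (auto simp: I_def is_partition_def)
    have pos: "0 < \<rho> (\<tau> (Suc i)) - \<rho> (\<tau> i)" if "i \<in> I" for i
      using rho_strict[OF t[OF that]] by simp
    have \<sigma>: "0 < \<sigma> i" if "i \<in> I" for i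
      using pos[OF that] that by (simp add: \<sigma>_def I_def)
    have indep0: "indep_vars (\<lambda>_. borel) D {..<n}"
    proof -
      have "independent_increments M a b X" using yeh unfolding yeh_process_def by blast
      then show ?thesis using p
        unfolding independent_increments_def is_partition_def D_def[abs_def] by auto
    qed
    have indep: "indep_vars (\<lambda>_. borel) (\<lambda>i \<omega>. - c i * m i + c i * D i \<omega>) I"
      by (rule indep_vars_compose2[where Y="\<lambda>i x. - c i * m i + c i * x",
            OF indep_vars_subset[OF indep0]]) (auto simp: I_def)
    have nrm: "distributed M lborel (\<lambda>\<omega>. - c i * m i + c i * D i \<omega>) (normal_density 0 (\<sigma> i))"
      if "i \<in> I" for i
    proof -
      have "distributed M lborel (D i) (normal_density (m i) (sqrt (\<rho> (\<tau> (Suc i)) - \<rho> (\<tau> i))))"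
        using distributed_increment[OF t[OF that]] by (simp add: D_def[abs_def] m_def)
      from normal_density_affine[OF this, of "c i" "- c i * m i"] show ?thesis
        using pos[OF that] that by (simp add: \<sigma>_def I_def)
    qed
    define s where "s = sqrt (\<Sum>i\<in>I. (\<sigma> i)\<^sup>2)"
    have "0 < (\<Sum>i\<in>I. (\<sigma> i)\<^sup>2)"
      using \<sigma> by (intro sum_pos finI False) (simp add: less_imp_neq[symmetric])
    then have s: "0 < s" by (simp add: s_def)
    have "distributed M lborel (\<lambda>\<omega>. \<Sum>i\<in>I. - c i * m i + c i * D i \<omega>)
        (normal_density (\<Sum>i\<in>I. 0) s)"
      unfolding s_def by (rule sum_indep_normal[OF finI False indep \<sigma> nrm])
    moreover have "(\<lambda>\<omega>. \<Sum>i\<in>I. - c i * m i + c i * D i \<omega>) = step_integral Y n \<tau> c"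
      by (intro ext si[symmetric])
    ultimately have "distributed M lborel (step_integral Y n \<tau> c) (normal_density 0 s)"
      by simp
    from centered_normal_moments[OF s this] show ?thesis by simp
  qed
qed

text \<open>The bound for step integrals survives the limit by Fatou's lemma along an almost surely convergent
  subsequence. From here on this inequality represents the Gaussian law.\<close>

lemma corresponds_fourth_moment:
  assumes "corresponds f Z"
  shows "(\<integral>\<^sup>+\<omega>. ennreal ((Z \<omega>)^4) \<partial>M) \<le> ennreal (3 * (sqnorm M Z)\<^sup>2)"
proof -
  obtain n \<tau> c where p: "\<And>k. is_partition a b (n k) (\<tau> k)"
    and lim: "L2_tendsto S (\<lambda>k. step_fun (n k) (\<tau> k) (c k)) f"
    using step_approximation[OF assms] by blast
  define I where "I k = step_integral Y (n k) (\<tau> k) (c k)" for k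
  have I: "L2_tendsto M I Z"
    unfolding I_def[abs_def] by (rule corresponds_step_limit[OF assms p lim])
  obtain r where r: "strict_mono r" "AE \<omega> in M. (\<lambda>k. I (r k) \<omega>) \<longlonglongrightarrow> Z \<omega>"
    using L2_tendsto_AE_subseq[OF I] .
  show ?thesis
  proof (rule nn_integral_Fatou_real[where F="\<lambda>k \<omega>. (I (r k) \<omega>)^4"])
    show "(\<lambda>\<omega>. (I (r k) \<omega>)^4) \<in> borel_measurable M" for k
    proof -
      have "sq_integrable M (I (r k))"
        unfolding I_def by (rule correspondsD(2)[OF corresponds_step[OF p]])
      then have "I (r k) \<in> borel_measurable M"
        by (rule sq_integrable_measurable)
      then show ?thesis by (rule borel_measurable_power)
    qed
    show "AE \<omega> in M. (\<lambda>k. (I (r k) \<omega>)^4) \<longlonglongrightarrow> (Z \<omega>)^4"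
      using r(2) by eventually_elim (intro tendsto_intros)
    show "(\<integral>\<^sup>+\<omega>. ennreal ((I (r k) \<omega>)^4) \<partial>M) \<le> ennreal (3 * (sqnorm M (I (r k)))\<^sup>2)" for k
      unfolding I_def by (rule step_fourth_moment[OF p])
    show "(\<lambda>k. 3 * (sqnorm M (I (r k)))\<^sup>2) \<longlonglongrightarrow> 3 * (sqnorm M Z)\<^sup>2"
      using LIMSEQ_subseq_LIMSEQ[OF sqnorm_tendsto[OF I] r(1)]
      by (intro tendsto_intros) (simp add: comp_def)
  qed
qed

end

section \<open>Orthonormal expansions\<close>

lemma sqnorm_diff_expand:
  assumes "sq_integrable M f" "sq_integrable M g"
  shows "sqnorm M (\<lambda>x. f x - g x) = sqnorm M f - 2 * (LINT x|M. f x * g x) + sqnorm M g"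
proof -
  have "sqnorm M (\<lambda>x. f x - g x) = (LINT x|M. (f x)\<^sup>2 - 2 * (f x * g x) + (g x)\<^sup>2)"
    by (intro Bochner_Integration.integral_cong) (auto simp: power2_diff)
  also have "\<dots> = sqnorm M f - 2 * (LINT x|M. f x * g x) + sqnorm M g"
    using assms sq_integrable_product[OF assms] by (simp add: sq_integrable_def)
  finally show ?thesis .
qed

lemma inner_sum:
  assumes "sq_integrable M f" "\<And>n. n \<in> I \<Longrightarrow> sq_integrable M (g n)"
  shows "(LINT x|M. f x * (\<Sum>n\<in>I. c n * g n x)) = (\<Sum>n\<in>I. c n * (LINT x|M. f x * g n x))"
proof -
  have "(LINT x|M. f x * (\<Sum>n\<in>I. c n * g n x)) = (LINT x|M. (\<Sum>n\<in>I. c n * (f x * g n x)))"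
    by (intro Bochner_Integration.integral_cong) (auto simp: sum_distrib_left algebra_simps)
  also have "\<dots> = (\<Sum>n\<in>I. LINT x|M. c n * (f x * g n x))"
    by (rule Bochner_Integration.integral_sum) (intro integrable_mult_right sq_integrable_product assms)
  finally show ?thesis by simp
qed

lemma orthonormal_sqnorm_sum:
  assumes sq: "\<And>n. sq_integrable M (\<phi> n)"
    and orth: "\<And>m n. (LINT x|M. \<phi> m x * \<phi> n x) = (if m = n then 1 else 0)"
    and I: "finite I"
  shows "sqnorm M (\<lambda>x. \<Sum>n\<in>I. c n * \<phi> n x) = (\<Sum>n\<in>I. (c n)\<^sup>2)"
proof -
  let ?g = "\<lambda>x. \<Sum>n\<in>I. c n * \<phi> n x"
  have g: "sq_integrable M ?g" by (intro sq_integrable_sum sq_integrable_cmult sq)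
  have "(LINT x|M. ?g x * \<phi> n x) = c n" if "n \<in> I" for n
  proof -
    have "(LINT x|M. ?g x * \<phi> n x) = (\<Sum>m\<in>I. c m * (if m = n then 1 else 0))"
      using inner_sum[where c=c and I=I and g=\<phi>, OF sq[of n] sq] by (simp add: orth mult.commute)
    also have "\<dots> = (\<Sum>m\<in>I. if m = n then c m else 0)" by (intro sum.cong) auto
    finally show ?thesis using that I by simp
  qed
  then have "(LINT x|M. ?g x * ?g x) = (\<Sum>n\<in>I. c n * c n)"
    using inner_sum[where c=c and I=I and g=\<phi>, OF g sq] by simp
  then show ?thesis by (simp add: power2_eq_square)
qed

lemma orthonormal_expansion_error:
  fixes \<phi> :: "nat \<Rightarrow> 'a \<Rightarrow> real"
  assumes sq: "\<And>n. sq_integrable M (\<phi> n)"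
    and orth: "\<And>m n. (LINT x|M. \<phi> m x * \<phi> n x) = (if m = n then 1 else 0)"
    and f: "sq_integrable M f"
  shows "sqnorm M (\<lambda>x. f x - (\<Sum>n<N. c n * \<phi> n x))
     = sqnorm M f - 2 * (\<Sum>n<N. c n * (LINT x|M. f x * \<phi> n x)) + (\<Sum>n<N. (c n)\<^sup>2)"
proof -
  have g: "sq_integrable M (\<lambda>x. \<Sum>n<N. c n * \<phi> n x)"
    by (intro sq_integrable_sum sq_integrable_cmult sq)
  show ?thesis
    using sqnorm_diff_expand[OF f g] inner_sum[where c=c and I="{..<N}" and g=\<phi>, OF f sq]
      orthonormal_sqnorm_sum[where c=c and I="{..<N}", OF sq orth] by simp
qed

text \<open>The Fourier coefficients give the best approximation from each span, so an arbitrary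
  approximating combination controls the Fourier partial sums from its length onwards.\<close>

lemma orthonormal_basis_expansion:
  assumes basis: "orthonormal_basis M \<phi>" and f: "sq_integrable M f"
  defines "\<alpha> \<equiv> \<lambda>n. LINT x|M. f x * \<phi> n x"
  shows "L2_tendsto M (\<lambda>N x. \<Sum>n<N. \<alpha> n * \<phi> n x) f"
    and "(\<lambda>N. \<Sum>n<N. (\<alpha> n)\<^sup>2) \<longlonglongrightarrow> sqnorm M f"
proof -
  have sq: "\<And>n. sq_integrable M (\<phi> n)"
    and orth: "\<And>m n. (LINT x|M. \<phi> m x * \<phi> n x) = (if m = n then 1 else 0)"
    and dense: "\<And>\<epsilon>. 0 < \<epsilon> \<Longrightarrow> \<exists>N c. sqnorm M (\<lambda>x. f x - (\<Sum>n<N. c n * \<phi> n x)) < \<epsilon>"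
    using basis f unfolding orthonormal_basis_def by blast+
  have err: "sqnorm M (\<lambda>x. f x - (\<Sum>n<N. \<alpha> n * \<phi> n x)) = sqnorm M f - (\<Sum>n<N. (\<alpha> n)\<^sup>2)" for N
    using orthonormal_expansion_error[where N=N and c=\<alpha>, OF sq orth f]
    by (simp add: \<alpha>_def power2_eq_square)
  have V0: "0 \<le> sqnorm M f - (\<Sum>n<N. (\<alpha> n)\<^sup>2)" for N
    unfolding err[symmetric] by (rule sqnorm_nonneg)
  have best: "sqnorm M f - (\<Sum>n<N. (\<alpha> n)\<^sup>2) \<le> sqnorm M (\<lambda>x. f x - (\<Sum>n<N. c n * \<phi> n x))" for N c
  proof -
    have "0 \<le> (\<Sum>n<N. (c n - \<alpha> n)\<^sup>2)" by (intro sum_nonneg) simp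
    also have "\<dots> = (\<Sum>n<N. (c n)\<^sup>2) - 2 * (\<Sum>n<N. c n * \<alpha> n) + (\<Sum>n<N. (\<alpha> n)\<^sup>2)"
      by (simp add: power2_diff sum.distrib sum_subtractf sum_distrib_left algebra_simps)
    finally show ?thesis
      using orthonormal_expansion_error[where N=N and c=c, OF sq orth f] by (simp add: \<alpha>_def)
  qed
  have mono: "(\<Sum>n<N. (\<alpha> n)\<^sup>2) \<le> (\<Sum>n<K. (\<alpha> n)\<^sup>2)" if "N \<le> K" for N K
    using that by (intro sum_mono2) auto
  show lim: "(\<lambda>N. \<Sum>n<N. (\<alpha> n)\<^sup>2) \<longlonglongrightarrow> sqnorm M f"
  proof (rule LIMSEQ_I)
    fix r :: real assume "0 < r"
    then obtain N c where N: "sqnorm M (\<lambda>x. f x - (\<Sum>n<N. c n * \<phi> n x)) < r"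
      using dense by blast
    have "\<bar>(\<Sum>n<K. (\<alpha> n)\<^sup>2) - sqnorm M f\<bar> < r" if "N \<le> K" for K
      using best[of N c] N mono[OF that] V0[of K] by linarith
    then show "\<exists>no. \<forall>K\<ge>no. norm ((\<Sum>n<K. (\<alpha> n)\<^sup>2) - sqnorm M f) < r" by auto
  qed
  show "L2_tendsto M (\<lambda>N x. \<Sum>n<N. \<alpha> n * \<phi> n x) f"
  proof (rule L2_tendstoI)
    show "sqnorm M (\<lambda>x. (\<Sum>n<N. \<alpha> n * \<phi> n x) - f x) \<le> sqnorm M f - (\<Sum>n<N. (\<alpha> n)\<^sup>2)" for N
      unfolding err[symmetric] by (subst sqnorm_commute) (rule order_refl)
    show "(\<lambda>N. sqnorm M f - (\<Sum>n<N. (\<alpha> n)\<^sup>2)) \<longlonglongrightarrow> 0"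
      using tendsto_diff[OF tendsto_const[of "sqnorm M f"] lim] by simp
  qed (intro sq_integrable_sum sq_integrable_cmult sq f)+
qed

section \<open>The series expansion\<close>

lemma tendsto_L2_and_AE_shift:
  assumes "tendsto_L2_and_AE M S Z" "sq_integrable M g"
    and "sq_integrable M W" "AE x in M. g x + Z x = W x"
  shows "tendsto_L2_and_AE M (\<lambda>N x. g x + S N x) W"
proof -
  have S: "\<And>N. sq_integrable M (S N)" "sq_integrable M Z"
    and lim: "(\<lambda>N. sqnorm M (\<lambda>x. S N x - Z x)) \<longlonglongrightarrow> 0"
    and ae: "AE x in M. (\<lambda>N. S N x) \<longlonglongrightarrow> Z x"
    using assms(1) by (simp_all add: tendsto_L2_and_AE_def L2_tendsto_def)
  have "L2_tendsto M (\<lambda>N x. g x + S N x) W"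
  proof (rule L2_tendstoI[OF _ assms(3) _ lim])
    show gS: "sq_integrable M (\<lambda>x. g x + S N x)" for N
      by (intro sq_integrable_add assms S)
    have "AE x in M. g x + S N x - W x = S N x - Z x" for N
      using assms(4) by eventually_elim simp
    then show "sqnorm M (\<lambda>x. g x + S N x - W x) \<le> sqnorm M (\<lambda>x. S N x - Z x)" for N
      by (intro order_eq_refl sqnorm_cong_AE sq_integrable_diff gS S assms(3))
  qed
  moreover have "AE x in M. (\<lambda>N. g x + S N x) \<longlonglongrightarrow> W x"
    using ae assms(4)
  proof eventually_elim
    case (elim x)
    from tendsto_add[OF tendsto_const[of "g x"] elim(1)] elim(2) show ?case by simp
  qed
  ultimately show ?thesis by (simp add: tendsto_L2_and_AE_def)
qed

context yeh
begin

text \<open>By isometry the remainder in mean square is that of the expansion of \<open>[a, t)\<close>, whose Fourier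
  coefficients are the integrals of \<open>\<phi> n\<close> over \<open>[a, t]\<close>. A block of the series is itself a Wiener
  integral with variance \<open>V j - V i\<close>, where \<open>V\<close> are the partial sums of the squared coefficients;
  so its fourth moment is at most \<open>3 (V j - V i)\<^sup>2\<close>, as required for almost sure convergence.\<close>

lemma increment_expansion:
  assumes basis: "orthonormal_basis S \<phi>" and t: "t \<in> {a..b}"
  shows "tendsto_L2_and_AE M (series_partial M a b \<rho> Y \<phi> t) (incr t)"
proof -
  define W where "W n = wiener_integral M a b \<rho> Y (\<phi> n)" for n
  define \<alpha> where "\<alpha> n = (LINT x|S. indicator {a..<t} x * \<phi> n x)" for n
  define T where "T N \<omega> = (\<Sum>n<N. \<alpha> n * W n \<omega>)" for N \<omega>
  define V where "V N = (\<Sum>n<N. (\<alpha> n)\<^sup>2)" for N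
  have sq: "\<And>n. sq_integrable S (\<phi> n)"
    and orth: "\<And>m n. (LINT x|S. \<phi> m x * \<phi> n x) = (if m = n then 1 else 0)"
    using basis unfolding orthonormal_basis_def by blast+
  have coeff: "(LINT s:{a..t}|S. \<phi> n s) = \<alpha> n" for n
    unfolding \<alpha>_def set_lebesgue_integral_def
  proof (rule integral_cong_AE)
    have "\<phi> n \<in> borel_measurable S" by (rule sq_integrable_measurable[OF sq])
    moreover have "(indicator {a..t} :: real \<Rightarrow> real) \<in> borel_measurable S"
      "(indicator {a..<t} :: real \<Rightarrow> real) \<in> borel_measurable S"
      by (rule measurable_S, simp)+
    ultimately show "(\<lambda>x. indicator {a..t} x *\<^sub>R \<phi> n x) \<in> borel_measurable S"
      "(\<lambda>x. indicator {a..<t} x * \<phi> n x) \<in> borel_measurable S"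
      by (auto intro!: borel_measurable_times)
    show "AE x in S. indicator {a..t} x *\<^sub>R \<phi> n x = indicator {a..<t} x * \<phi> n x"
      using AE_S_neq[of t] by eventually_elim (auto simp: indicator_def)
  qed
  have T: "series_partial M a b \<rho> Y \<phi> t = T"
    by (intro ext) (simp add: series_partial_def T_def W_def coeff)
  have W: "corresponds (\<phi> n) (W n)" for n
    unfolding W_def by (rule corresponds_wiener_integral[OF sq])
  have corrT: "corresponds (\<lambda>x. \<Sum>n<N. \<alpha> n * \<phi> n x) (T N)" for N
    unfolding T_def[abs_def] by (intro corresponds_sum W) simp
  have corr_t: "corresponds (indicator {a..<t}) (incr t)" by (rule corresponds_base[OF t])
  note exp = orthonormal_basis_expansion[OF basis correspondsD(1)[OF corr_t], folded \<alpha>_def]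
  have L2: "L2_tendsto M T (incr t)"
  proof (rule L2_tendstoI)
    show "sqnorm M (\<lambda>x. T N x - incr t x)
        \<le> sqnorm S (\<lambda>x. (\<Sum>n<N. \<alpha> n * \<phi> n x) - indicator {a..<t} x)" for N
      using corresponds_sqnorm[OF corresponds_diff[OF corrT corr_t], of N] by simp
    show "(\<lambda>N. sqnorm S (\<lambda>x. (\<Sum>n<N. \<alpha> n * \<phi> n x) - indicator {a..<t} x)) \<longlonglongrightarrow> 0"
      using exp(1) unfolding L2_tendsto_def by blast
  qed (rule correspondsD(2)[OF corrT] correspondsD(2)[OF corr_t])+
  have "AE \<omega> in M. convergent (\<lambda>N. T N \<omega>)"
  proof (rule AE_convergent_of_fourth_moments)
    show "T N \<in> borel_measurable M" for N
      by (rule sq_integrable_measurable[OF correspondsD(2)[OF corrT]])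
    show "mono V" unfolding V_def by (intro monoI sum_mono2) auto
    show "V \<longlonglongrightarrow> sqnorm S (indicator {a..<t})" using exp(2) by (simp add: V_def[abs_def])
    fix i j :: nat assume ij: "i \<le> j"
    have split: "{..<j} - {..<i} = {i..<j}" using ij by auto
    have diff: "(\<Sum>n<j. g n) - (\<Sum>n<i. g n) = (\<Sum>n\<in>{i..<j}. g n)" for g :: "nat \<Rightarrow> real"
      using sum_diff[of "{..<j}" "{..<i}" g] ij by (simp add: split)
    have corr: "corresponds (\<lambda>x. \<Sum>n\<in>{i..<j}. \<alpha> n * \<phi> n x) (\<lambda>\<omega>. T j \<omega> - T i \<omega>)"
      unfolding T_def diff by (intro corresponds_sum W) simp
    have "sqnorm M (\<lambda>\<omega>. T j \<omega> - T i \<omega>) = V j - V i"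
      unfolding corresponds_sqnorm[OF corr, symmetric] V_def diff
      by (rule orthonormal_sqnorm_sum[OF sq orth]) simp
    then show "(\<integral>\<^sup>+\<omega>. ennreal ((T j \<omega> - T i \<omega>)^4) \<partial>M) \<le> ennreal (3 * (V j - V i)\<^sup>2)"
      using corresponds_fourth_moment[OF corr] by simp
  qed
  with L2 show ?thesis unfolding T by (rule L2_tendsto_and_AE)
qed

end

theorem mainTheorem6:
  fixes a b :: real and lam \<rho> :: "real \<Rightarrow> real"
    and M :: "'w measure" and X :: "real \<Rightarrow> 'w \<Rightarrow> real"
    and \<phi> :: "nat \<Rightarrow> real \<Rightarrow> real"
  assumes "0 \<le> a" and "a < b"
    and "continuous_on {a..b} lam" and "bounded_variation_on a b lam"
    and "continuous_on {a..b} \<rho>" and "mono_on {a..b} \<rho>"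
    and "equivalent_measures (stieltjes_on a b \<rho>) (lebesgue_on {a..b})"
    and "yeh_process M a b lam \<rho> X"
    and "orthonormal_basis (stieltjes_on a b \<rho>) \<phi>"
  shows
    "(\<rho> a = 0 \<longrightarrow> (\<forall>t\<in>{a..b}.
        tendsto_L2_and_AE M
          (\<lambda>N \<omega>. series_partial M a b \<rho> (centered lam X) \<phi> t N \<omega>)
          (\<lambda>\<omega>. centered lam X t \<omega>) \<and>
        tendsto_L2_and_AE M
          (\<lambda>N \<omega>. lam t + series_partial M a b \<rho> (centered lam X) \<phi> t N \<omega>)
          (\<lambda>\<omega>. X t \<omega>))) \<and>
     (\<forall>t\<in>{a..b}.
        tendsto_L2_and_AE M
          (\<lambda>N \<omega>. centered lam X a \<omega> + series_partial M a b \<rho> (centered lam X) \<phi> t N \<omega>)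
          (\<lambda>\<omega>. centered lam X t \<omega>) \<and>
        tendsto_L2_and_AE M
          (\<lambda>N \<omega>. lam t + centered lam X a \<omega> + series_partial M a b \<rho> (centered lam X) \<phi> t N \<omega>)
          (\<lambda>\<omega>. X t \<omega>))"
proof -
  interpret yeh a b \<rho> M lam X
    by unfold_locales (fact assms)+
  have a: "a \<in> {a..b}" using ab by simp
  note exp = increment_expansion[OF assms(9)]
  note shift = tendsto_L2_and_AE_shift[OF exp]
  show ?thesis
  proof (intro conjI impI ballI)
    fix t assume t: "t \<in> {a..b}"
    show "tendsto_L2_and_AE M (\<lambda>N \<omega>. Y a \<omega> + series_partial M a b \<rho> Y \<phi> t N \<omega>) (\<lambda>\<omega>. Y t \<omega>)"
      by (rule shift[OF t sq_Y[OF a] sq_Y[OF t]]) (simp add: incr_def)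
    show "tendsto_L2_and_AE M (\<lambda>N \<omega>. lam t + Y a \<omega> + series_partial M a b \<rho> Y \<phi> t N \<omega>) (\<lambda>\<omega>. X t \<omega>)"
      by (rule shift[OF t sq_integrable_add[OF sq_const sq_Y[OF a]] sq_X[OF t]])
        (simp add: incr_def centered_def)
  next
    fix t assume \<rho>: "\<rho> a = 0" and t: "t \<in> {a..b}"
    have "sqnorm M (Y a) = 0"
      using covariance_Y[of a a] a \<rho> by (simp add: power2_eq_square)
    then have Ya: "AE \<omega> in M. Y a \<omega> = 0" by (rule sqnorm_zero_imp_AE[OF sq_Y[OF a]])
    have "tendsto_L2_and_AE M (\<lambda>N \<omega>. 0 + series_partial M a b \<rho> Y \<phi> t N \<omega>) (\<lambda>\<omega>. Y t \<omega>)"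
      by (rule shift[OF t sq_const sq_Y[OF t]]) (use Ya in eventually_elim, simp add: incr_def)
    then show "tendsto_L2_and_AE M (\<lambda>N \<omega>. series_partial M a b \<rho> Y \<phi> t N \<omega>) (\<lambda>\<omega>. Y t \<omega>)"
      by simp
    show "tendsto_L2_and_AE M (\<lambda>N \<omega>. lam t + series_partial M a b \<rho> Y \<phi> t N \<omega>) (\<lambda>\<omega>. X t \<omega>)"
      by (rule shift[OF t sq_const sq_X[OF t]]) (use Ya in eventually_elim, simp add: incr_def centered_def)
  qed
qed

end
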